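(* Let $\mathcal{M}$ be an MDP, $B$ a set of absorbing target states, $c$ a non-negative cost function and $\beta\in(0,1)$. Consider the mixed-integer linear program $$\begin{aligned} \underset{\lambda^1_{s,a},\lambda^2_{s,a},\Delta_{s,a}}{\text{minimize}}\quad &\sum_{s\in S}\sum_{a\in\mathcal{A}}c(s,a)\lambda^1_{s,a}\\ \text{subject to}\quad &\sum_{a\in\mathcal{A}}\lambda^1_{s,a}-\beta\sum_{s'\in S}\sum_{a\in\mathcal{A}}\mathcal{P}_{s',a,s}\lambda^1_{s',a}=\alpha_s,\quad\forall s\in S\\ &\sum_{a\in\mathcal{A}}\lambda^2_{s,a}-\sum_{s'\in S}\sum_{a\in\mathcal{A}}\mathcal{P}_{s',a,s}\lambda^2_{s',a}=\alpha_s,\quad\forall s\in S_r\\ &\sum_{s\in S_r}\sum_{a\in\mathcal{A}}\lambda^2_{s,a}r(s,a)=x_{s_1}\\ &\lambda^k_{s,a}/M\leq\Delta_{s,a},\quad\forall k\in\{1,2\},\ \forall s\in S,\ \forall a\in\mathcal{A}\\ &\sum_{a\in\mathcal{A}}\Delta_{s,a}\leq1,\quad\forall s\in S\\ &\lambda^1_{s,a}\geq0,\ \lambda^2_{s,a}\geq0,\ \Delta_{s,a}\in\{0,1\}. \end{aligned}$$ Let the constant $M$ be chosen such that $M\geq M^{\star}$. Then, for $K\in\mathbb{R}$, there exists a policy $\pi\in\Xi^{SD}(\mathcal{M},B)$ such that $J(\pi)\leq K$ if and only if the optimal value of this program is less than or equal to $K$. Furthermore, an optimal policy $\pi_D^{\star}\in\Xi^{SD}(\mathcal{M},B)$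 (i.e., one minimizing $J$ over $\Xi^{SD}(\mathcal{M},B)$) such that $J(\pi_D^{\star})\leq K$ can be obtained from the optimal variables $\{\Delta^{\star}_{s,a}:s\in S,a\in\mathcal{A}\}$ of the program by the rule $$\pi_D^{\star}(s,a)=\begin{cases}\Delta^{\star}_{s,a}&\text{if }\sum_{a\in\mathcal{A}}\Delta^{\star}_{s,a}=1,\\ \text{arbitrary}&\text{otherwise,}\end{cases}$$ where "arbitrary" means an arbitrary deterministic choice of an available action in $s$.
   Context: A Markov decision process (MDP) is a tuple $\mathcal{M}=(S,s_1,\mathcal{A},\mathcal{P})$ with $S$ a finite set of states, $s_1\in S$ an initial state, $\mathcal{A}$ a finite set of actions, $\mathcal{A}(s)\subseteq\mathcal{A}$ the (nonempty) set of actions available in $s$, and $\mathcal{P}:S\times\mathcal{A}\times S\to[0,1]$ with $\sum_{s'\in S}\mathcal{P}_{s,a,s'}=1$ for all $s\in S$, $a\in\mathcal{A}(s)$. A state $s$ is absorbing if $\mathcal{P}_{s,a,s}=1$ for all $a\in\mathcal{A}(s)$. In the program, variables are indexed by, and sums run over, available state-action pairs ($a\in\mathcal{A}(s)$). A policy is a sequence $\pi=(d_1,d_2,\ldots)$ of maps $d_t:S\times\mathcal{A}\to[0,1]$ with $\sum_{a\in\mathcal{A}(s)}d_t(s,a)=1$ for all $s$; $\Pi(\mathcal{M})$ is the set of all policies. A policy is stationary deterministic if all $d_t$ are equal (write $\pi(s,a)=d_1(s,a)$) and for each $s$ some $a\in\mathcal{A}(s)$ has $\pi(s,a)=1$; $\Pi^{SD}(\mathcal{M})$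 is the set of these. $\Pr^{\pi}_{\mathcal{M}}(Reach[B])$ is the probability that the random path $s_1s_2\ldots$ generated under $\pi$ satisfies $s_t\in B$ for some $t\geq1$. $\Xi^{SD}(\mathcal{M},B)$ is the set of $\pi\in\Pi^{SD}(\mathcal{M})$ attaining $\max_{\pi'\in\Pi(\mathcal{M})}\Pr^{\pi'}_{\mathcal{M}}(Reach[B])$. $J(\pi)=\mathbb{E}^{\pi}\big[\sum_{t=1}^{\infty}\beta^{t-1}c(s_t,a_t)\big]$ with $c:S\times\mathcal{A}\to\mathbb{R}_{\geq0}$. $S_0\subseteq S$ is the set of states having zero probability of reaching $B$ under every policy, and $S_r=S\setminus(B\cup S_0)$. $\alpha_s=1$ if $s=s_1$ and $\alpha_s=0$ otherwise. $x_{s_1}$ is the maximum probability, over all policies, of reaching $B$ from $s_1$. $r(s,a)=\sum_{s'\in B}\mathcal{P}_{s,a,s'}$ if $s\in S_r$ and $r(s,a)=0$ otherwise. $f(s,a)=1$ if $s\in S_r$ and $f(s,a)=0$ otherwise, and $$M^{\star}=\max_{\pi\in\Xi^{SD}(\mathcal{M},B)}\mathbb{E}^{\pi}\Big[\sum_{t=1}^{\infty}f(s_t,a_t)\Big],$$ which is finite. The optimal value of an infeasible program is $+\infty$.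
   Formalization: The formal theorem additionally assumes that the initial state s_1 is not in B and that M ≥ 1/(1-β) besides M ≥ M*; without either condition the program can be infeasible although a suitable policy exists. *)

theory Defs
  imports "HOL-Probability.Probability"
begin

section \<open>Markov decision processes\<close>

text \<open>The transition probability \<open>P\<^bsub>s,a,s'\<^esub>\<close> is \<open>pmf (tr M s a) s'\<close>.  Only its values
  at states \<open>s\<close> and actions \<open>a\<close> available in \<open>s\<close> are constrained or ever used; there the
  support condition below says that \<open>P\<^bsub>s,a,_\<^esub>\<close> sums to 1 over the state set.\<close>

record ('s, 'a) mdp =
  states :: "'s set"
  s_init :: 's
  actions :: "'a set"
  avail :: "'s \<Rightarrow> 'a set"
  tr :: "'s \<Rightarrow> 'a \<Rightarrow> 's pmf"

definition is_mdp :: "('s, 'a) mdp \<Rightarrow> bool" where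
  "is_mdp M \<longleftrightarrow>
     finite (states M) \<and> s_init M \<in> states M \<and> finite (actions M) \<and>
     (\<forall>s\<in>states M. avail M s \<noteq> {} \<and> avail M s \<subseteq> actions M \<and>
        (\<forall>a\<in>avail M s. set_pmf (tr M s a) \<subseteq> states M))"

definition absorbing :: "('s, 'a) mdp \<Rightarrow> 's \<Rightarrow> bool" where
  "absorbing M s \<longleftrightarrow> s \<in> states M \<and> (\<forall>a\<in>avail M s. pmf (tr M s a) s = 1)"

section \<open>Policies\<close>

text \<open>Time is counted from 0: \<open>\<pi> t s\<close> is the distribution of the action chosen in state \<open>s\<close>
  at the \<open>(t+1)\<close>-st step, that is, \<open>pmf (\<pi> t s) a\<close> is \<open>d\<^bsub>t+1\<^esub>(s,a)\<close>.\<close>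

type_synonym ('s, 'a) policy = "nat \<Rightarrow> 's \<Rightarrow> 'a pmf"

definition policies :: "('s, 'a) mdp \<Rightarrow> ('s, 'a) policy set" where
  "policies M = {\<pi>. \<forall>t. \<forall>s\<in>states M. set_pmf (\<pi> t s) \<subseteq> avail M s}"

definition policies_SD :: "('s, 'a) mdp \<Rightarrow> ('s, 'a) policy set" where
  "policies_SD M =
     {\<pi> \<in> policies M.
        (\<forall>t. \<forall>s\<in>states M. \<pi> t s = \<pi> 0 s) \<and>
        (\<forall>s\<in>states M. \<exists>a\<in>avail M s. pmf (\<pi> 0 s) a = 1)}"

section \<open>The random path generated by a policy\<close>

text \<open>A path is a function \<open>\<omega>\<close> with \<open>\<omega> t = (s\<^bsub>t+1\<^esub>, a\<^bsub>t+1\<^esub>)\<close>.  Its law, for a path started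
  in \<open>s0\<close>, is the Ionescu-Tulcea measure of the kernels \<open>path_step\<close>, which give the conditional
  law of \<open>\<omega> t\<close> given the restriction of \<open>\<omega>\<close> to times before \<open>t\<close>.\<close>

definition path_step ::
  "('s, 'a) mdp \<Rightarrow> ('s, 'a) policy \<Rightarrow> 's \<Rightarrow> nat \<Rightarrow> (nat \<Rightarrow> 's \<times> 'a) \<Rightarrow> ('s \<times> 'a) measure" where
  "path_step M \<pi> s0 t \<omega> = measure_pmf
     (bind_pmf (case t of 0 \<Rightarrow> return_pmf s0 | Suc n \<Rightarrow> tr M (fst (\<omega> n)) (snd (\<omega> n)))
        (\<lambda>s. map_pmf (Pair s) (\<pi> t s)))"

definition path_measure ::
  "('s, 'a) mdp \<Rightarrow> ('s, 'a) policy \<Rightarrow> 's \<Rightarrow> (nat \<Rightarrow> 's \<times> 'a) measure" where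
  "path_measure M \<pi> s0 =
     projective_family.lim UNIV
       (Ionescu_Tulcea.CI (path_step M \<pi> s0) (\<lambda>_. count_space UNIV)) (\<lambda>_. count_space UNIV)"

lemma measurable_path_step:
  "path_step M \<pi> s0 i
    \<in> measurable (PiM {0..<i} (\<lambda>_. count_space UNIV)) (subprob_algebra (count_space UNIV))"
proof (cases i)
  case 0
  show ?thesis
    unfolding path_step_def[abs_def] 0 nat.case
    by (intro measurable_const) (simp add: space_subprob_algebra measure_pmf.subprob_space_axioms)
next
  case (Suc n)
  have "(\<lambda>\<omega>. \<omega> n) \<in> measurable (PiM {0..<Suc n} (\<lambda>_. count_space UNIV)) (count_space UNIV)"
    by (rule measurable_component_singleton) simp
  moreover have "(\<lambda>p. measure_pmf (bind_pmf (tr M (fst p) (snd p))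
        (\<lambda>s. map_pmf (Pair s) (\<pi> (Suc n) s))))
      \<in> measurable (count_space UNIV) (subprob_algebra (count_space UNIV))"
    by (simp add: space_subprob_algebra measure_pmf.subprob_space_axioms)
  ultimately show ?thesis
    unfolding Suc path_step_def[abs_def] nat.case
    by (rule measurable_compose)
qed

lemma Ionescu_Tulcea_path_step:
  "Ionescu_Tulcea (path_step M \<pi> s0) (\<lambda>_. count_space UNIV)"
  unfolding Ionescu_Tulcea_def
  by (auto simp: measurable_path_step path_step_def measure_pmf.prob_space_axioms)

definition reach_prob ::
  "('s, 'a) mdp \<Rightarrow> ('s, 'a) policy \<Rightarrow> 's \<Rightarrow> 's set \<Rightarrow> real" where
  "reach_prob M \<pi> s0 B = measure (path_measure M \<pi> s0) {\<omega>. \<exists>t. fst (\<omega> t) \<in> B}"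

definition max_reach_prob :: "('s, 'a) mdp \<Rightarrow> 's set \<Rightarrow> real" where
  "max_reach_prob M B = (SUP \<pi>\<in>policies M. reach_prob M \<pi> (s_init M) B)"

definition policies_Xi :: "('s, 'a) mdp \<Rightarrow> 's set \<Rightarrow> ('s, 'a) policy set" where
  "policies_Xi M B =
     {\<pi> \<in> policies_SD M. reach_prob M \<pi> (s_init M) B = max_reach_prob M B}"

definition disc_cost ::
  "('s, 'a) mdp \<Rightarrow> real \<Rightarrow> ('s \<Rightarrow> 'a \<Rightarrow> real) \<Rightarrow> ('s, 'a) policy \<Rightarrow> real" where
  "disc_cost M \<beta> c \<pi> =
     (\<integral>\<omega>. (\<Sum>t. \<beta> ^ t * c (fst (\<omega> t)) (snd (\<omega> t))) \<partial>path_measure M \<pi> (s_init M))"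

section \<open>Data of the program\<close>

definition S0 :: "('s, 'a) mdp \<Rightarrow> 's set \<Rightarrow> 's set" where
  "S0 M B = {s \<in> states M. \<forall>\<pi>\<in>policies M. reach_prob M \<pi> s B = 0}"

definition Sr :: "('s, 'a) mdp \<Rightarrow> 's set \<Rightarrow> 's set" where
  "Sr M B = states M - (B \<union> S0 M B)"

definition init_weight :: "('s, 'a) mdp \<Rightarrow> 's \<Rightarrow> real" where
  "init_weight M s = (if s = s_init M then 1 else 0)"

definition reach_reward :: "('s, 'a) mdp \<Rightarrow> 's set \<Rightarrow> 's \<Rightarrow> 'a \<Rightarrow> real" where
  "reach_reward M B s a = (if s \<in> Sr M B then \<Sum>s'\<in>B. pmf (tr M s a) s' else 0)"

definition stay_reward :: "('s, 'a) mdp \<Rightarrow> 's set \<Rightarrow> 's \<Rightarrow> 'a \<Rightarrow> ennreal" where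
  "stay_reward M B s a = (if s \<in> Sr M B then 1 else 0)"

definition M_star :: "('s, 'a) mdp \<Rightarrow> 's set \<Rightarrow> ennreal" where
  "M_star M B =
     (SUP \<pi>\<in>policies_Xi M B.
        \<integral>\<^sup>+\<omega>. (\<Sum>t. stay_reward M B (fst (\<omega> t)) (snd (\<omega> t))) \<partial>path_measure M \<pi> (s_init M))"

section \<open>The mixed-integer linear program\<close>

text \<open>In the following, \<open>l1\<close>, \<open>l2\<close> and \<open>D\<close> are the variables \<open>\<lambda>\<^sup>1\<close>, \<open>\<lambda>\<^sup>2\<close> and \<open>\<Delta>\<close>, and \<open>L\<close> is
  the big-M constant.  Values of the variables at pairs \<open>(s,a)\<close> other than available
  state-action pairs play no role.

  \<open>M_star\<close> bounds only \<open>\<lambda>\<^sup>2\<close> on \<open>Sr\<close>; the total mass of \<open>\<lambda>\<^sup>1\<close> is \<open>1 / (1 - \<beta>)\<close>, most of which may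
  lie on \<open>B\<close> and \<open>S0\<close>, so \<open>L \<ge> M_star\<close> alone can make the program infeasible.  It is also
  infeasible when the initial state is in \<open>B\<close>: then \<open>\<lambda>\<^sup>2\<close> has no source on \<open>Sr\<close>, the
  left-hand side of the reachability constraint is 0, and the right-hand side is 1.\<close>

definition milp_feasible ::
  "('s, 'a) mdp \<Rightarrow> 's set \<Rightarrow> real \<Rightarrow> real \<Rightarrow>
     ('s \<Rightarrow> 'a \<Rightarrow> real) \<Rightarrow> ('s \<Rightarrow> 'a \<Rightarrow> real) \<Rightarrow> ('s \<Rightarrow> 'a \<Rightarrow> real) \<Rightarrow> bool" where
  "milp_feasible M B \<beta> L l1 l2 D \<longleftrightarrow>
     (\<forall>s\<in>states M.
        (\<Sum>a\<in>avail M s. l1 s a)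
          - \<beta> * (\<Sum>s'\<in>states M. \<Sum>a\<in>avail M s'. pmf (tr M s' a) s * l1 s' a)
        = init_weight M s) \<and>
     (\<forall>s\<in>Sr M B.
        (\<Sum>a\<in>avail M s. l2 s a)
          - (\<Sum>s'\<in>states M. \<Sum>a\<in>avail M s'. pmf (tr M s' a) s * l2 s' a)
        = init_weight M s) \<and>
     (\<Sum>s\<in>Sr M B. \<Sum>a\<in>avail M s. l2 s a * reach_reward M B s a) = max_reach_prob M B \<and>
     (\<forall>s\<in>states M. \<forall>a\<in>avail M s. l1 s a / L \<le> D s a \<and> l2 s a / L \<le> D s a) \<and>
     (\<forall>s\<in>states M. (\<Sum>a\<in>avail M s. D s a) \<le> 1) \<and>
     (\<forall>s\<in>states M. \<forall>a\<in>avail M s. 0 \<le> l1 s a \<and> 0 \<le> l2 s a \<and> D s a \<in> {0, 1})"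

definition milp_objective ::
  "('s, 'a) mdp \<Rightarrow> ('s \<Rightarrow> 'a \<Rightarrow> real) \<Rightarrow> ('s \<Rightarrow> 'a \<Rightarrow> real) \<Rightarrow> real" where
  "milp_objective M c l1 = (\<Sum>s\<in>states M. \<Sum>a\<in>avail M s. c s a * l1 s a)"

text \<open>The infimum is taken in the extended reals, so it is \<open>\<infinity>\<close> for an infeasible program.\<close>

definition milp_value ::
  "('s, 'a) mdp \<Rightarrow> 's set \<Rightarrow> ('s \<Rightarrow> 'a \<Rightarrow> real) \<Rightarrow> real \<Rightarrow> real \<Rightarrow> ereal" where
  "milp_value M B c \<beta> L =
     Inf {ereal (milp_objective M c l1) | l1 l2 D. milp_feasible M B \<beta> L l1 l2 D}"

definition milp_optimal ::
  "('s, 'a) mdp \<Rightarrow> 's set \<Rightarrow> ('s \<Rightarrow> 'a \<Rightarrow> real) \<Rightarrow> real \<Rightarrow> real \<Rightarrow>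
     ('s \<Rightarrow> 'a \<Rightarrow> real) \<Rightarrow> ('s \<Rightarrow> 'a \<Rightarrow> real) \<Rightarrow> ('s \<Rightarrow> 'a \<Rightarrow> real) \<Rightarrow> bool" where
  "milp_optimal M B c \<beta> L l1 l2 D \<longleftrightarrow>
     milp_feasible M B \<beta> L l1 l2 D \<and>
     ereal (milp_objective M c l1) = milp_value M B c \<beta> L"

text \<open>All stationary deterministic policies that the extraction rule can produce from \<open>D\<close>.  In a
  state where \<open>D\<close> does not sum to 1, membership in \<open>policies_SD M\<close> is the only requirement.\<close>

definition extracted_policies ::
  "('s, 'a) mdp \<Rightarrow> ('s \<Rightarrow> 'a \<Rightarrow> real) \<Rightarrow> ('s, 'a) policy set" where
  "extracted_policies M D =
     {\<pi> \<in> policies_SD M.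
        \<forall>s\<in>states M. (\<Sum>a\<in>avail M s. D s a) = 1 \<longrightarrow> (\<forall>a\<in>avail M s. pmf (\<pi> 0 s) a = D s a)}"

end

(* For a stationary deterministic policy, the flow constraints of the program pair with the Bellman
   equations of the policy: multiplying the lambda^1-flow at s by the discounted value of s, and the
   lambda^2-flow at s by the probability of reaching B from s, and summing over s shows that any
   flows supported on the actions of the policy have objective J(pi), and that the left-hand side
   of the reachability constraint is the reachability probability of the policy. The big-M
   constraints force every feasible flow to be supported on the actions of every extracted policy,
   which therefore maximizes the reachability probability. Conversely, the occupation measures of a
   policy in Xi^SD are feasible flows, bounded by 1/(1 - beta) and by M_star. Hence the objective
   values of the program are exactly the costs J(pi) of the policies in Xi^SD, a finite set. *)
theory Submission
  imports Defs
begin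

section \<open>Marginals of the path measure\<close>

text \<open>Reachability, cost and residence time are all reduced to these marginals, so that later
  arguments handle finite sums and series instead of the path space.\<close>

primrec state_pmf :: "('s, 'a) mdp \<Rightarrow> ('s, 'a) policy \<Rightarrow> 's \<Rightarrow> nat \<Rightarrow> 's pmf" where
  "state_pmf M \<pi> s0 0 = return_pmf s0"
| "state_pmf M \<pi> s0 (Suc t) =
     bind_pmf (state_pmf M \<pi> s0 t) (\<lambda>s. bind_pmf (\<pi> t s) (tr M s))"

definition sa_pmf :: "('s, 'a) mdp \<Rightarrow> ('s, 'a) policy \<Rightarrow> 's \<Rightarrow> nat \<Rightarrow> ('s \<times> 'a) pmf" where
  "sa_pmf M \<pi> s0 t = bind_pmf (state_pmf M \<pi> s0 t) (\<lambda>s. map_pmf (Pair s) (\<pi> t s))"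

text \<open>\<open>path_step\<close> looks only at the last entry of the history. This is the
  resulting Markov kernel, with \<open>p\<close> the preceding pair and \<open>t\<close> the time of
  the new one.\<close>

definition step_pmf ::
  "('s, 'a) mdp \<Rightarrow> ('s, 'a) policy \<Rightarrow> nat \<Rightarrow> 's \<times> 'a \<Rightarrow> ('s \<times> 'a) pmf" where
  "step_pmf M \<pi> t p = bind_pmf (tr M (fst p) (snd p)) (\<lambda>s. map_pmf (Pair s) (\<pi> t s))"

lemma sa_pmf_Suc: "sa_pmf M \<pi> s0 (Suc t) = bind_pmf (sa_pmf M \<pi> s0 t) (step_pmf M \<pi> (Suc t))"
  by (simp add: sa_pmf_def step_pmf_def bind_assoc_pmf bind_map_pmf)

lemma map_fst_sa_pmf: "map_pmf fst (sa_pmf M \<pi> s0 t) = state_pmf M \<pi> s0 t"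
  by (simp add: sa_pmf_def map_bind_pmf pmf.map_comp comp_def map_pmf_const bind_return_pmf')

lemma path_step_0: "path_step M \<pi> s0 0 \<omega> = measure_pmf (sa_pmf M \<pi> s0 0)"
  by (simp add: path_step_def sa_pmf_def)

lemma path_step_Suc: "path_step M \<pi> s0 (Suc n) \<omega> = measure_pmf (step_pmf M \<pi> (Suc n) (\<omega> n))"
  by (simp add: path_step_def step_pmf_def)

lemma sets_path_measure [measurable_cong]:
  "sets (path_measure M \<pi> s0) = sets (PiM UNIV (\<lambda>_. count_space UNIV))"
proof -
  interpret Ionescu_Tulcea "path_step M \<pi> s0" "\<lambda>_. count_space UNIV"
    by (rule Ionescu_Tulcea_path_step)
  show ?thesis
    unfolding path_measure_def by (rule PF.sets_lim)
qed

lemma space_path_measure [simp]: "space (path_measure M \<pi> s0) = UNIV"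
  using sets_eq_imp_space_eq[OF sets_path_measure, of M \<pi> s0] by (simp add: space_PiM)

lemma measurable_path_component [measurable]:
  "(\<lambda>\<omega>. \<omega> t) \<in> measurable (path_measure M \<pi> s0) (count_space UNIV)"
  by (subst measurable_cong_sets[OF sets_path_measure refl]) (rule measurable_component_singleton, simp)

lemma measurable_path_fun [measurable]:
  "(\<lambda>\<omega>. h (\<omega> t)) \<in> borel_measurable (path_measure M \<pi> s0)"
  by (rule measurable_compose[OF measurable_path_component]) simp

text \<open>The path measure is the projective limit of the family \<open>CI\<close>, whose member
  on an initial segment of times is the composition \<open>C 0 n\<close> of the first
  \<open>n\<close> kernels. The last argument of \<open>C\<close> is the empty history.\<close>

lemma nn_integral_path_measure_restrict:
  fixes f :: "(nat \<Rightarrow> 's \<times> 'a) \<Rightarrow> ennreal"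
  assumes f: "f \<in> borel_measurable (PiM {0..<n} (\<lambda>_. count_space UNIV))"
  shows "(\<integral>\<^sup>+\<omega>. f (restrict \<omega> {0..<n}) \<partial>path_measure M \<pi> s0) =
    (\<integral>\<^sup>+\<omega>. f \<omega> \<partial>Ionescu_Tulcea.C (path_step M \<pi> s0) (\<lambda>_. count_space UNIV) 0 n (\<lambda>_. undefined))"
proof -
  interpret Ionescu_Tulcea "path_step M \<pi> s0" "\<lambda>_. count_space UNIV"
    by (rule Ionescu_Tulcea_path_step)
  \<comment> \<open>\<open>up_to\<close> is the length of the shortest initial segment of times that
    covers a finite index set.\<close>
  have up: "up_to {0..<n} = n"
    using up_to_iff_Ico[of "{0..<n}"]
    by (metis finite_atLeastLessThan le_antisym order_refl ivl_subset nat_le_linear le0 le_zero_eq)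
  have sp: "space (C 0 n (\<lambda>_. undefined)) = space (PiM {0..<n} (\<lambda>_. count_space UNIV))"
    by (simp add: space_C[of _ 0, simplified])
  have st: "sets (C 0 n (\<lambda>_. undefined)) = sets (PiM {0..<n} (\<lambda>_. count_space UNIV))"
    by (simp add: sets_C[of _ 0, simplified])
  have "(\<integral>\<^sup>+\<omega>. f (restrict \<omega> {0..<n}) \<partial>path_measure M \<pi> s0) =
      (\<integral>\<^sup>+\<omega>. f \<omega> \<partial>distr PF.lim (PiM {0..<n} (\<lambda>_. count_space UNIV)) (\<lambda>\<omega>. restrict \<omega> {0..<n}))"
    unfolding path_measure_def
    using f by (subst nn_integral_distr)
      (auto simp: measurable_cong_sets[OF PF.sets_lim refl] intro!: measurable_restrict measurable_component_singleton)
  also have "\<dots> = (\<integral>\<^sup>+\<omega>. f \<omega> \<partial>CI {0..<n})"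
    by (subst distr_lim) auto
  also have "\<dots> = (\<integral>\<^sup>+\<omega>. f (restrict \<omega> {0..<n}) \<partial>C 0 n (\<lambda>_. undefined))"
    unfolding CI_def up
    using f by (subst nn_integral_distr)
      (auto simp: measurable_cong_sets[OF st refl] intro!: measurable_restrict measurable_component_singleton)
  \<comment> \<open>Points of the finite product are extensional, so restricting them changes
    nothing.\<close>
  also have "\<dots> = (\<integral>\<^sup>+\<omega>. f \<omega> \<partial>C 0 n (\<lambda>_. undefined))"
    by (rule nn_integral_cong) (auto simp: sp space_PiM)
  finally show ?thesis .
qed

lemma nn_integral_path_measure_0:
  fixes k :: "'s \<times> 'a \<Rightarrow> ennreal"
  shows "(\<integral>\<^sup>+\<omega>. k (\<omega> 0) \<partial>path_measure M \<pi> s0) = (\<integral>\<^sup>+x. k x \<partial>sa_pmf M \<pi> s0 0)"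
proof -
  interpret Ionescu_Tulcea "path_step M \<pi> s0" "\<lambda>_. count_space UNIV"
    by (rule Ionescu_Tulcea_path_step)
  have 1: "(\<lambda>\<omega>. k (\<omega> 0)) \<in> borel_measurable (PiM {0..<Suc 0} (\<lambda>_. count_space UNIV))"
    by (rule measurable_compose[OF measurable_component_singleton]) auto
  have "(\<integral>\<^sup>+\<omega>. k (\<omega> 0) \<partial>path_measure M \<pi> s0) = (\<integral>\<^sup>+\<omega>. k (\<omega> 0) \<partial>C 0 (Suc 0) (\<lambda>_. undefined))"
    using nn_integral_path_measure_restrict[OF 1, of M \<pi> s0] by simp
  also have "\<dots> = (\<integral>\<^sup>+\<omega>. k (\<omega> 0) \<partial>eP 0 (\<lambda>_. undefined))"
    using measurable_eP[of 0] by (simp add: bind_return[of _ _ "PiM {0..<Suc 0} (\<lambda>_. count_space UNIV)"])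
  also have "\<dots> = (\<integral>\<^sup>+x. k x \<partial>sa_pmf M \<pi> s0 0)"
    using 1 by (subst nn_integral_eP) (auto simp: path_step_0)
  finally show ?thesis .
qed

text \<open>Stated for products only: over uncountable types, a function of the pair
  \<open>(\<omega> t, \<omega> (Suc t))\<close> need not be measurable.\<close>

lemma nn_integral_path_measure_Suc:
  fixes M :: "('s, 'a) mdp" and h k :: "'s \<times> 'a \<Rightarrow> ennreal"
  shows "(\<integral>\<^sup>+\<omega>. h (\<omega> t) * k (\<omega> (Suc t)) \<partial>path_measure M \<pi> s0) =
    (\<integral>\<^sup>+\<omega>. h (\<omega> t) * (\<integral>\<^sup>+y. k y \<partial>step_pmf M \<pi> (Suc t) (\<omega> t)) \<partial>path_measure M \<pi> s0)"
proof -
  interpret Ionescu_Tulcea "path_step M \<pi> s0" "\<lambda>_. count_space UNIV"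
    by (rule Ionescu_Tulcea_path_step)
  have comp: "(\<lambda>\<omega>. g (\<omega> i)) \<in> borel_measurable (PiM {0..<n} (\<lambda>_. count_space UNIV))"
    if "i < n" for g :: "'s \<times> 'a \<Rightarrow> ennreal" and i n :: nat
    using that by (intro measurable_compose[OF measurable_component_singleton[of i]]) auto
  have 1: "(\<lambda>\<omega>. h (\<omega> t) * k (\<omega> (Suc t))) \<in> borel_measurable (PiM {0..<Suc (Suc t)} (\<lambda>_. count_space UNIV))"
    by (intro borel_measurable_times_ennreal comp) auto
  have 2: "(\<lambda>\<omega>. h (\<omega> t) * (\<integral>\<^sup>+y. k y \<partial>step_pmf M \<pi> (Suc t) (\<omega> t)))
      \<in> borel_measurable (PiM {0..<Suc t} (\<lambda>_. count_space UNIV))"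
    by (rule comp[where g="\<lambda>x. h x * (\<integral>\<^sup>+y. k y \<partial>step_pmf M \<pi> (Suc t) x)"]) simp
  have sp: "space (C 0 n (\<lambda>_. undefined)) = space (PiM {0..<n} (\<lambda>_. count_space UNIV))" for n
    by (simp add: space_C[of _ 0, simplified])
  have st: "sets (C 0 n (\<lambda>_. undefined)) = sets (PiM {0..<n} (\<lambda>_. count_space UNIV))" for n
    by (simp add: sets_C[of _ 0, simplified])
  have "(\<integral>\<^sup>+\<omega>. h (\<omega> t) * k (\<omega> (Suc t)) \<partial>path_measure M \<pi> s0) =
      (\<integral>\<^sup>+\<omega>. h (\<omega> t) * k (\<omega> (Suc t)) \<partial>C 0 (Suc (Suc t)) (\<lambda>_. undefined))"
    using nn_integral_path_measure_restrict[OF 1, of M \<pi> s0] by simp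
  \<comment> \<open>Peel off the last kernel: \<open>eP (Suc t) \<omega>\<close> is the law of the
    history \<open>\<omega>\<close> extended by one random entry.\<close>
  also have "\<dots> = (\<integral>\<^sup>+\<omega>. (\<integral>\<^sup>+\<omega>'. h (\<omega>' t) * k (\<omega>' (Suc t)) \<partial>eP (Suc t) \<omega>) \<partial>C 0 (Suc t) (\<lambda>_. undefined))"
    unfolding C.simps(2)[of 0 "Suc t"] add_0
    by (rule nn_integral_bind[OF 1])
      (subst measurable_cong_sets[OF st refl], rule measurable_eP)
  also have "\<dots> = (\<integral>\<^sup>+\<omega>. h (\<omega> t) * (\<integral>\<^sup>+y. k y \<partial>step_pmf M \<pi> (Suc t) (\<omega> t)) \<partial>C 0 (Suc t) (\<lambda>_. undefined))"
  proof (rule nn_integral_cong)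
    fix \<omega> assume "\<omega> \<in> space (C 0 (Suc t) (\<lambda>_. undefined))"
    then have "\<omega> \<in> space (PiM {0..<Suc t} (\<lambda>_. count_space UNIV))"
      by (simp only: sp)
    \<comment> \<open>The extension agrees with \<open>\<omega>\<close> at time \<open>t\<close>, so
      \<open>h (\<omega> t)\<close> is a constant factor of the inner integral.\<close>
    from nn_integral_eP[OF this 1]
    show "(\<integral>\<^sup>+\<omega>'. h (\<omega>' t) * k (\<omega>' (Suc t)) \<partial>eP (Suc t) \<omega>) =
        h (\<omega> t) * (\<integral>\<^sup>+y. k y \<partial>step_pmf M \<pi> (Suc t) (\<omega> t))"
      by (simp add: path_step_Suc nn_integral_cmult)
  qed
  also have "\<dots> = (\<integral>\<^sup>+\<omega>. h (\<omega> t) * (\<integral>\<^sup>+y. k y \<partial>step_pmf M \<pi> (Suc t) (\<omega> t)) \<partial>path_measure M \<pi> s0)"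
    using nn_integral_path_measure_restrict[OF 2, of M \<pi> s0] by simp
  finally show ?thesis .
qed

text \<open>The Markov property (with \<open>h\<close> constantly 1) replaces a function of the pair
  at \<open>Suc t\<close> by its conditional expectation, a function of the pair at
  \<open>t\<close>. Hence \<open>k\<close> stays arbitrary in the induction.\<close>

lemma nn_integral_path_measure:
  fixes k :: "'s \<times> 'a \<Rightarrow> ennreal"
  shows "(\<integral>\<^sup>+\<omega>. k (\<omega> t) \<partial>path_measure M \<pi> s0) = (\<integral>\<^sup>+x. k x \<partial>sa_pmf M \<pi> s0 t)"
proof (induction t arbitrary: k)
  case 0
  then show ?case by (rule nn_integral_path_measure_0)
next
  case (Suc t)
  have "(\<integral>\<^sup>+\<omega>. k (\<omega> (Suc t)) \<partial>path_measure M \<pi> s0) =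
      (\<integral>\<^sup>+\<omega>. (\<integral>\<^sup>+y. k y \<partial>step_pmf M \<pi> (Suc t) (\<omega> t)) \<partial>path_measure M \<pi> s0)"
    using nn_integral_path_measure_Suc[where h="\<lambda>_. 1" and t=t and k=k and M=M and \<pi>=\<pi> and ?s0.0=s0] by simp
  also have "\<dots> = (\<integral>\<^sup>+x. (\<integral>\<^sup>+y. k y \<partial>step_pmf M \<pi> (Suc t) x) \<partial>sa_pmf M \<pi> s0 t)"
    by (rule Suc.IH)
  also have "\<dots> = (\<integral>\<^sup>+x. k x \<partial>sa_pmf M \<pi> s0 (Suc t))"
    by (simp add: sa_pmf_Suc)
  finally show ?case .
qed

lemma distr_path_measure:
  fixes M :: "('s, 'a) mdp"
  shows "distr (path_measure M \<pi> s0) (count_space UNIV) (\<lambda>\<omega>. \<omega> t) = measure_pmf (sa_pmf M \<pi> s0 t)"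
proof (rule measure_eqI)
  fix A :: "('s \<times> 'a) set"
  have "emeasure (distr (path_measure M \<pi> s0) (count_space UNIV) (\<lambda>\<omega>. \<omega> t)) A =
      (\<integral>\<^sup>+x. indicator A x \<partial>distr (path_measure M \<pi> s0) (count_space UNIV) (\<lambda>\<omega>. \<omega> t))"
    by simp
  also have "\<dots> = (\<integral>\<^sup>+\<omega>. indicator A (\<omega> t) \<partial>path_measure M \<pi> s0)"
    by (rule nn_integral_distr) auto
  also have "\<dots> = emeasure (sa_pmf M \<pi> s0 t) A"
    by (simp add: nn_integral_path_measure)
  finally show "emeasure (distr (path_measure M \<pi> s0) (count_space UNIV) (\<lambda>\<omega>. \<omega> t)) A =
      emeasure (sa_pmf M \<pi> s0 t) A" .
qed simp

text \<open>The total mass can be read off from any image measure, and the law of the first pair has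
  mass 1.\<close>

lemma prob_space_path_measure: "prob_space (path_measure M \<pi> s0)"
  using distr_path_measure[of M \<pi> s0 0]
  by (intro prob_space_distrD[where f="\<lambda>\<omega>. \<omega> 0" and N="count_space UNIV"])
     (simp_all add: measure_pmf.prob_space_axioms)

lemma AE_path_measure: "AE \<omega> in path_measure M \<pi> s0. \<omega> t \<in> set_pmf (sa_pmf M \<pi> s0 t)"
proof -
  have "AE x in distr (path_measure M \<pi> s0) (count_space UNIV) (\<lambda>\<omega>. \<omega> t). x \<in> set_pmf (sa_pmf M \<pi> s0 t)"
    unfolding distr_path_measure by (simp add: AE_measure_pmf)
  then show ?thesis
    by (subst (asm) AE_distr_iff) auto
qed

lemma sets_path_state_in: "{\<omega>. fst (\<omega> t) \<in> A} \<in> sets (path_measure M \<pi> s0)"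
  using measurable_sets[OF measurable_path_component, of "fst -` A" t M \<pi> s0]
  by (simp add: vimage_def)

lemma measure_path_measure_state:
  "measure (path_measure M \<pi> s0) {\<omega>. fst (\<omega> t) \<in> A} = measure (state_pmf M \<pi> s0 t) A"
proof -
  have "measure (path_measure M \<pi> s0) {\<omega>. fst (\<omega> t) \<in> A} =
      measure (distr (path_measure M \<pi> s0) (count_space UNIV) (\<lambda>\<omega>. \<omega> t)) (fst -` A)"
    by (subst measure_distr) (auto simp: vimage_def)
  then show ?thesis
    by (simp add: distr_path_measure flip: map_fst_sa_pmf)
qed

section \<open>Reachability, cost and residence time as functions of the marginals\<close>

lemma set_state_pmf:
  assumes "is_mdp M" "\<pi> \<in> policies M" "s0 \<in> states M"
  shows "set_pmf (state_pmf M \<pi> s0 t) \<subseteq> states M"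
proof (induction t)
  case (Suc t)
  have "set_pmf (bind_pmf (\<pi> t s) (tr M s)) \<subseteq> states M" if "s \<in> states M" for s
  proof
    fix s' assume "s' \<in> set_pmf (bind_pmf (\<pi> t s) (tr M s))"
    then obtain a where "a \<in> set_pmf (\<pi> t s)" "s' \<in> set_pmf (tr M s a)" by auto
    with assms(1,2) that show "s' \<in> states M"
      unfolding is_mdp_def policies_def by blast
  qed
  then show ?case
    unfolding state_pmf.simps set_bind_pmf using Suc by blast
qed (use assms in simp)

lemma set_sa_pmf:
  assumes "is_mdp M" "\<pi> \<in> policies M" "s0 \<in> states M"
  shows "set_pmf (sa_pmf M \<pi> s0 t) \<subseteq> (SIGMA s:states M. avail M s)"
  using set_state_pmf[OF assms, of t] assms(2) by (auto simp: sa_pmf_def policies_def)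

lemma finite_avail: "is_mdp M \<Longrightarrow> s \<in> states M \<Longrightarrow> finite (avail M s)"
  by (auto simp: is_mdp_def intro: finite_subset)

lemma pmf_eq_1_imp_return: "pmf p x = 1 \<Longrightarrow> p = return_pmf x"
proof -
  assume "pmf p x = 1"
  then have "measure p {x} = 1" by (simp add: measure_pmf_single)
  then have "AE y in p. y \<in> {x}" by (subst (asm) measure_pmf.prob_eq_1) auto
  then have "set_pmf p \<subseteq> {x}" by (simp add: AE_measure_pmf_iff subset_iff)
  then show ?thesis by (simp add: set_pmf_subset_singleton)
qed

text \<open>The probability of being in \<open>B\<close> at \<open>t\<close> and outside
  \<open>B\<close> at \<open>Suc t\<close> is the integral of a product of indicators. Conditioning
  on the pair at \<open>t\<close> makes it 0, because the kernel does not move away from an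
  absorbing state.\<close>

lemma AE_stays_in_absorbing:
  fixes M :: "('s, 'a) mdp"
  assumes M: "is_mdp M" "\<pi> \<in> policies M" "s0 \<in> states M"
    and B: "\<forall>s\<in>B. absorbing M s"
  shows "AE \<omega> in path_measure M \<pi> s0. fst (\<omega> t) \<in> B \<longrightarrow> fst (\<omega> (Suc t)) \<in> B"
proof -
  let ?h = "indicator {x. fst x \<in> B} :: 's \<times> 'a \<Rightarrow> ennreal"
  let ?k = "indicator {x. fst x \<notin> B} :: 's \<times> 'a \<Rightarrow> ennreal"
  have "(\<integral>\<^sup>+\<omega>. ?h (\<omega> t) * ?k (\<omega> (Suc t)) \<partial>path_measure M \<pi> s0) =
      (\<integral>\<^sup>+x. ?h x * (\<integral>\<^sup>+y. ?k y \<partial>step_pmf M \<pi> (Suc t) x) \<partial>sa_pmf M \<pi> s0 t)"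
    by (subst nn_integral_path_measure_Suc)
      (rule nn_integral_path_measure[where k="\<lambda>x. ?h x * (\<integral>\<^sup>+y. ?k y \<partial>step_pmf M \<pi> (Suc t) x)"])
  also have "\<dots> = (\<integral>\<^sup>+x. 0 \<partial>sa_pmf M \<pi> s0 t)"
  proof (rule nn_integral_cong_AE, subst AE_measure_pmf_iff, intro ballI)
    fix x assume x: "x \<in> set_pmf (sa_pmf M \<pi> s0 t)"
    show "?h x * (\<integral>\<^sup>+y. ?k y \<partial>step_pmf M \<pi> (Suc t) x) = 0"
    proof (cases "fst x \<in> B")
      case True
      with x set_sa_pmf[OF M, of t] B have "pmf (tr M (fst x) (snd x)) (fst x) = 1"
        by (auto simp: absorbing_def)
      then have "tr M (fst x) (snd x) = return_pmf (fst x)"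
        by (rule pmf_eq_1_imp_return)
      with True have "(\<integral>\<^sup>+y. ?k y \<partial>step_pmf M \<pi> (Suc t) x) = 0"
        by (simp add: step_pmf_def bind_return_pmf vimage_def)
      then show ?thesis by simp
    qed simp
  qed
  finally have "(\<integral>\<^sup>+\<omega>. ?h (\<omega> t) * ?k (\<omega> (Suc t)) \<partial>path_measure M \<pi> s0) = 0"
    by simp
  moreover have "(\<lambda>\<omega>. ?h (\<omega> t) * ?k (\<omega> (Suc t))) \<in> borel_measurable (path_measure M \<pi> s0)"
    by (intro borel_measurable_times_ennreal measurable_path_fun)
  ultimately have "AE \<omega> in path_measure M \<pi> s0. ?h (\<omega> t) * ?k (\<omega> (Suc t)) = 0"
    by (simp only: nn_integral_0_iff_AE)
  then show ?thesis
    by (rule AE_mp) (auto split: split_indicator)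
qed

text \<open>The events that \<open>B\<close> has been visited by time \<open>t\<close> increase to
  the event that \<open>B\<close> is reached. As \<open>B\<close> is almost surely never left, each
  of them has the same probability as being in \<open>B\<close> at time \<open>t\<close>.\<close>

lemma reach_prob_LIMSEQ:
  fixes M :: "('s, 'a) mdp"
  assumes M: "is_mdp M" "\<pi> \<in> policies M" "s0 \<in> states M"
    and B: "\<forall>s\<in>B. absorbing M s"
  shows "(\<lambda>t. measure (state_pmf M \<pi> s0 t) B) \<longlonglongrightarrow> reach_prob M \<pi> s0 B"
proof -
  interpret prob_space "path_measure M \<pi> s0" by (rule prob_space_path_measure)
  let ?A = "\<lambda>t. {\<omega> :: nat \<Rightarrow> 's \<times> 'a. \<exists>i\<le>t. fst (\<omega> i) \<in> B}"
  note sets = sets_path_state_in[of _ B M \<pi> s0]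
  have A: "?A t \<in> events" for t
  proof -
    have "?A t = (\<Union>i\<in>{..t}. {\<omega>. fst (\<omega> i) \<in> B})" by auto
    also have "\<dots> \<in> events" using sets by (intro sets.finite_UN) auto
    finally show ?thesis .
  qed
  have "(\<lambda>t. prob (?A t)) \<longlonglongrightarrow> prob (\<Union>t. ?A t)"
    using A by (intro finite_Lim_measure_incseq) (auto simp: incseq_def intro: order_trans)
  also have "(\<Union>t. ?A t) = {\<omega>. \<exists>t. fst (\<omega> t) \<in> B}"
  proof (intro equalityI subsetI)
    fix \<omega> :: "nat \<Rightarrow> 's \<times> 'a" assume "\<omega> \<in> {\<omega>. \<exists>t. fst (\<omega> t) \<in> B}"
    then obtain t where "fst (\<omega> t) \<in> B" by auto
    then show "\<omega> \<in> (\<Union>t. ?A t)" by (intro UN_I[of t]) auto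
  qed auto
  finally have "(\<lambda>t. prob (?A t)) \<longlonglongrightarrow> reach_prob M \<pi> s0 B"
    by (simp add: reach_prob_def)
  moreover have "prob (?A t) = measure (state_pmf M \<pi> s0 t) B" for t
  proof -
    have "AE \<omega> in path_measure M \<pi> s0. \<forall>t. fst (\<omega> t) \<in> B \<longrightarrow> fst (\<omega> (Suc t)) \<in> B"
      using AE_stays_in_absorbing[OF M B] by (subst AE_all_countable) auto
    then have "AE \<omega> in path_measure M \<pi> s0. \<omega> \<in> ?A t \<longleftrightarrow> \<omega> \<in> {\<omega>. fst (\<omega> t) \<in> B}"
    proof (rule AE_mp, intro AE_I2 impI)
      fix \<omega> :: "nat \<Rightarrow> 's \<times> 'a"
      assume *: "\<forall>t. fst (\<omega> t) \<in> B \<longrightarrow> fst (\<omega> (Suc t)) \<in> B"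
      have "fst (\<omega> t) \<in> B" if "i \<le> t" "fst (\<omega> i) \<in> B" for i
        using that by (induction rule: dec_induct) (use * in auto)
      then show "\<omega> \<in> ?A t \<longleftrightarrow> \<omega> \<in> {\<omega>. fst (\<omega> t) \<in> B}" by auto
    qed
    then have "prob (?A t) = prob {\<omega>. fst (\<omega> t) \<in> B}"
      by (rule finite_measure_eq_AE) (use A sets in auto)
    then show ?thesis by (simp add: measure_path_measure_state)
  qed
  ultimately show ?thesis by simp
qed

lemma reach_prob_ge_state_pmf:
  fixes M :: "('s, 'a) mdp"
  shows "measure (state_pmf M \<pi> s0 t) B \<le> reach_prob M \<pi> s0 B"
proof -
  interpret prob_space "path_measure M \<pi> s0" by (rule prob_space_path_measure)
  note sets = sets_path_state_in[of _ B M \<pi> s0]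
  have "(\<Union>i. {\<omega>. fst (\<omega> i) \<in> B}) \<in> events"
    by (rule sets.countable_UN) (use sets in auto)
  moreover have "(\<Union>i. {\<omega>. fst (\<omega> i) \<in> B}) = {\<omega> :: nat \<Rightarrow> 's \<times> 'a. \<exists>t. fst (\<omega> t) \<in> B}"
    by auto
  ultimately show ?thesis
    unfolding reach_prob_def measure_path_measure_state[symmetric]
    by (intro finite_measure_mono) auto
qed

text \<open>Almost every path uses only the finitely many available pairs, so the costs are bounded
  and a geometric series justifies exchanging sum and expectation.\<close>

lemma disc_cost_eq_suminf:
  fixes M :: "('s, 'a) mdp"
  assumes M: "is_mdp M" "\<pi> \<in> policies M" and \<beta>: "0 < \<beta>" "\<beta> < 1"
  shows "disc_cost M \<beta> c \<pi> =
    (\<Sum>t. \<beta> ^ t * (\<integral>x. c (fst x) (snd x) \<partial>sa_pmf M \<pi> (s_init M) t))"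
proof -
  let ?P = "path_measure M \<pi> (s_init M)"
  interpret prob_space ?P by (rule prob_space_path_measure)
  have init: "s_init M \<in> states M" using M by (simp add: is_mdp_def)
  let ?SA = "SIGMA s:states M. avail M s"
  have fin: "finite ?SA"
    using M(1) by (intro finite_SigmaI finite_avail) (auto simp: is_mdp_def)
  \<comment> \<open>A crude bound: the sum of all absolute costs dominates each of them.\<close>
  define C where "C = (\<Sum>x\<in>?SA. \<bar>c (fst x) (snd x)\<bar>)"
  have C: "\<bar>c (fst x) (snd x)\<bar> \<le> C" if "x \<in> ?SA" for x
    unfolding C_def using fin that by (intro member_le_sum) auto
  have AE: "AE \<omega> in ?P. \<forall>t. \<bar>c (fst (\<omega> t)) (snd (\<omega> t))\<bar> \<le> C"
    unfolding AE_all_countable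
  proof
    fix t
    show "AE \<omega> in ?P. \<bar>c (fst (\<omega> t)) (snd (\<omega> t))\<bar> \<le> C"
      using AE_path_measure[of t M \<pi> "s_init M"]
      by (rule AE_mp) (intro AE_I2 impI C, use set_sa_pmf[OF M init, of t] in auto)
  qed
  have meas[measurable]: "(\<lambda>\<omega>. c (fst (\<omega> t)) (snd (\<omega> t))) \<in> borel_measurable ?P" for t
    using measurable_path_fun[of "\<lambda>x. c (fst x) (snd x)" t] .
  have int: "integrable ?P (\<lambda>\<omega>. c (fst (\<omega> t)) (snd (\<omega> t)))" for t
    using AE by (intro integrable_const_bound[where B=C]) auto
  have "summable (\<lambda>t. C * \<beta> ^ t)"
    using \<beta> by (intro summable_mult summable_geometric) auto
  then have bound: "summable (\<lambda>t. \<beta> ^ t * C)" by (simp add: mult.commute)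
  have "disc_cost M \<beta> c \<pi> = (\<Sum>t. \<integral>\<omega>. \<beta> ^ t * c (fst (\<omega> t)) (snd (\<omega> t)) \<partial>?P)"
    unfolding disc_cost_def
  proof (rule integral_suminf)
    show "AE \<omega> in ?P. summable (\<lambda>t. norm (\<beta> ^ t * c (fst (\<omega> t)) (snd (\<omega> t))))"
      using AE
    proof (rule AE_mp, intro AE_I2 impI)
      fix \<omega> :: "nat \<Rightarrow> 's \<times> 'a" assume "\<forall>t. \<bar>c (fst (\<omega> t)) (snd (\<omega> t))\<bar> \<le> C"
      then show "summable (\<lambda>t. norm (\<beta> ^ t * c (fst (\<omega> t)) (snd (\<omega> t))))"
        using \<beta> by (intro summable_comparison_test'[OF bound, of 0]) (auto simp: abs_mult)
    qed
    have "(\<integral>\<omega>. norm (\<beta> ^ t * c (fst (\<omega> t)) (snd (\<omega> t))) \<partial>?P) \<le> \<beta> ^ t * C" for t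
    proof -
      have "(\<integral>\<omega>. \<bar>c (fst (\<omega> t)) (snd (\<omega> t))\<bar> \<partial>?P) \<le> (\<integral>\<omega>. C \<partial>?P)"
        using AE int by (intro integral_mono_AE) auto
      then show ?thesis
        using \<beta> prob_space by (simp add: abs_mult)
    qed
    then show "summable (\<lambda>t. \<integral>\<omega>. norm (\<beta> ^ t * c (fst (\<omega> t)) (snd (\<omega> t))) \<partial>?P)"
      by (intro summable_comparison_test'[OF bound, of 0]) auto
  qed (use int in auto)
  also have "\<dots> = (\<Sum>t. \<beta> ^ t * (\<integral>x. c (fst x) (snd x) \<partial>sa_pmf M \<pi> (s_init M) t))"
    by (subst distr_path_measure[symmetric], subst integral_distr) auto
  finally show ?thesis .
qed

text \<open>Expresses the residence times behind \<open>M_star\<close> as series of the occupation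
  probabilities of \<open>Sr\<close>, from which the \<open>l2\<close>-flow of a policy is
  built.\<close>

lemma nn_integral_stay_reward:
  "(\<integral>\<^sup>+\<omega>. (\<Sum>t. stay_reward M B (fst (\<omega> t)) (snd (\<omega> t))) \<partial>path_measure M \<pi> s0) =
    (\<Sum>t. ennreal (measure (state_pmf M \<pi> s0 t) (Sr M B)))"
proof -
  have meas: "(\<lambda>\<omega>. stay_reward M B (fst (\<omega> t)) (snd (\<omega> t))) \<in> borel_measurable (path_measure M \<pi> s0)" for t
    using measurable_path_fun[of "\<lambda>x. stay_reward M B (fst x) (snd x)" t] .
  have "(\<integral>\<^sup>+\<omega>. stay_reward M B (fst (\<omega> t)) (snd (\<omega> t)) \<partial>path_measure M \<pi> s0) =
      ennreal (measure (state_pmf M \<pi> s0 t) (Sr M B))" for t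
  proof -
    have "(\<integral>\<^sup>+\<omega>. stay_reward M B (fst (\<omega> t)) (snd (\<omega> t)) \<partial>path_measure M \<pi> s0) =
        (\<integral>\<^sup>+x. stay_reward M B (fst x) (snd x) \<partial>sa_pmf M \<pi> s0 t)"
      by (rule nn_integral_path_measure[where k="\<lambda>x. stay_reward M B (fst x) (snd x)"])
    also have "\<dots> = (\<integral>\<^sup>+s. indicator (Sr M B) s \<partial>map_pmf fst (sa_pmf M \<pi> s0 t))"
      unfolding nn_integral_map_pmf by (rule nn_integral_cong) (simp add: stay_reward_def indicator_def)
    finally show ?thesis
      by (simp add: map_fst_sa_pmf measure_pmf.emeasure_eq_measure)
  qed
  then show ?thesis
    by (subst nn_integral_suminf[OF meas]) (simp only:)
qed

text \<open>The defining recursion appends a last step, whereas Bellman equations condition on the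
  first one. After that step the policy runs with its clock shifted.\<close>

lemma state_pmf_Suc_front:
  "state_pmf M \<pi> s0 (Suc t) =
     bind_pmf (bind_pmf (\<pi> 0 s0) (tr M s0)) (\<lambda>s. state_pmf M (\<lambda>t. \<pi> (Suc t)) s t)"
  by (induction t) (simp_all add: bind_return_pmf bind_return_pmf' bind_assoc_pmf)

text \<open>The process never leaves \<open>states M\<close>, so what a policy does elsewhere has no
  effect. This identifies a stationary policy with its time shift, and policies with the same choice
  function.\<close>

lemma state_pmf_cong:
  assumes "is_mdp M" "\<pi> \<in> policies M" "s0 \<in> states M"
    and "\<And>t s. s \<in> states M \<Longrightarrow> \<pi> t s = \<pi>' t s"
  shows "state_pmf M \<pi> s0 t = state_pmf M \<pi>' s0 t"
proof (induction t)
  case (Suc t)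
  have "\<pi> t s = \<pi>' t s" if "s \<in> set_pmf (state_pmf M \<pi>' s0 t)" for s
    using that set_state_pmf[OF assms(1-3), of t] assms(4) Suc by auto
  with Suc show ?case by (auto intro!: bind_pmf_cong)
qed simp

section \<open>Bellman equations of stationary deterministic policies\<close>

text \<open>Replaces the distributions of a stationary deterministic policy by a choice function
  \<open>f\<close>, which is what makes sums over actions collapse to one term.\<close>

definition selects :: "('s, 'a) mdp \<Rightarrow> ('s, 'a) policy \<Rightarrow> ('s \<Rightarrow> 'a) \<Rightarrow> bool" where
  "selects M \<pi> f \<longleftrightarrow> (\<forall>s\<in>states M. f s \<in> avail M s \<and> (\<forall>t. \<pi> t s = return_pmf (f s)))"

lemma policies_SD_selects:
  assumes "\<pi> \<in> policies_SD M"
  obtains f where "selects M \<pi> f"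
proof -
  have "\<forall>s\<in>states M. \<exists>a. a \<in> avail M s \<and> (\<forall>t. \<pi> t s = return_pmf a)"
  proof
    fix s assume s: "s \<in> states M"
    then obtain a where a: "a \<in> avail M s" "pmf (\<pi> 0 s) a = 1"
      using assms unfolding policies_SD_def by blast
    moreover have "\<pi> t s = \<pi> 0 s" for t
      using assms s unfolding policies_SD_def by blast
    ultimately show "\<exists>a. a \<in> avail M s \<and> (\<forall>t. \<pi> t s = return_pmf a)"
      using pmf_eq_1_imp_return[OF a(2)] by auto
  qed
  then obtain f where "\<forall>s\<in>states M. f s \<in> avail M s \<and> (\<forall>t. \<pi> t s = return_pmf (f s))"
    by (auto dest!: bchoice)
  with that show ?thesis by (auto simp: selects_def)
qed

lemma selects_imp_policies_SD: "selects M \<pi> f \<Longrightarrow> \<pi> \<in> policies_SD M"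
  by (auto simp: selects_def policies_SD_def policies_def pmf_return intro!: bexI)

lemma policies_SD_subset: "\<pi> \<in> policies_SD M \<Longrightarrow> \<pi> \<in> policies M"
  by (simp add: policies_SD_def)

lemma selects_imp_policies: "selects M \<pi> f \<Longrightarrow> \<pi> \<in> policies M"
  by (rule policies_SD_subset[OF selects_imp_policies_SD])

lemma finite_states: "is_mdp M \<Longrightarrow> finite (states M)"
  by (simp add: is_mdp_def)

lemma set_tr: "is_mdp M \<Longrightarrow> s \<in> states M \<Longrightarrow> a \<in> avail M s \<Longrightarrow> set_pmf (tr M s a) \<subseteq> states M"
  by (auto simp: is_mdp_def)

text \<open>The forward equation, which yields the flow constraints for occupation measures.\<close>

lemma pmf_state_pmf_Suc:
  assumes M: "is_mdp M" and f: "selects M \<pi> f" and s0: "s0 \<in> states M"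
  shows "pmf (state_pmf M \<pi> s0 (Suc t)) s' =
    (\<Sum>s\<in>states M. pmf (tr M s (f s)) s' * pmf (state_pmf M \<pi> s0 t) s)"
proof -
  note set = set_state_pmf[OF M selects_imp_policies[OF f] s0, of t]
  have "state_pmf M \<pi> s0 (Suc t) = bind_pmf (state_pmf M \<pi> s0 t) (\<lambda>s. tr M s (f s))"
    unfolding state_pmf.simps
    by (rule bind_pmf_cong) (use f set in \<open>auto simp: selects_def bind_return_pmf\<close>)
  also have "pmf \<dots> s' = (\<Sum>s\<in>states M. pmf (tr M s (f s)) s' * pmf (state_pmf M \<pi> s0 t) s)"
    unfolding pmf_bind by (rule integral_measure_pmf_real) (use finite_states[OF M] set in auto)
  finally show ?thesis .
qed

text \<open>The backward equation, which yields the Bellman equations.\<close>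

lemma pmf_state_pmf_Suc_front:
  assumes M: "is_mdp M" and f: "selects M \<pi> f" and s0: "s0 \<in> states M"
  shows "pmf (state_pmf M \<pi> s0 (Suc t)) s' =
    (\<Sum>s\<in>states M. pmf (state_pmf M \<pi> s t) s' * pmf (tr M s0 (f s0)) s)"
proof -
  have set: "set_pmf (tr M s0 (f s0)) \<subseteq> states M"
    using f s0 by (intro set_tr[OF M]) (auto simp: selects_def)
  have "state_pmf M \<pi> s0 (Suc t) = bind_pmf (tr M s0 (f s0)) (\<lambda>s. state_pmf M (\<lambda>t. \<pi> (Suc t)) s t)"
    unfolding state_pmf_Suc_front using f s0 by (simp add: selects_def bind_return_pmf)
  also have "\<dots> = bind_pmf (tr M s0 (f s0)) (\<lambda>s. state_pmf M \<pi> s t)"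
  proof (rule bind_pmf_cong[OF refl])
    fix s assume "s \<in> set_pmf (tr M s0 (f s0))"
    then have "s \<in> states M" using set by auto
    then show "state_pmf M (\<lambda>t. \<pi> (Suc t)) s t = state_pmf M \<pi> s t"
      using f by (intro state_pmf_cong[OF M, symmetric] selects_imp_policies[OF f]) (auto simp: selects_def)
  qed
  also have "pmf \<dots> s' = (\<Sum>s\<in>states M. pmf (state_pmf M \<pi> s t) s' * pmf (tr M s0 (f s0)) s)"
    unfolding pmf_bind by (rule integral_measure_pmf_real) (use finite_states[OF M] set in auto)
  finally show ?thesis .
qed

section \<open>Bellman equations for reachability probability and discounted cost\<close>

lemma reach_prob_le_1: "reach_prob M \<pi> s B \<le> 1"
  unfolding reach_prob_def by (rule prob_space.prob_le_1[OF prob_space_path_measure])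

lemma reach_prob_target: "s \<in> B \<Longrightarrow> reach_prob M \<pi> s B = 1"
  using reach_prob_ge_state_pmf[of M \<pi> s 0 B] reach_prob_le_1[of M \<pi> s B] by simp

text \<open>The backward equation summed over \<open>B\<close> relates the probabilities of being in
  \<open>B\<close> at times \<open>Suc t\<close> and \<open>t\<close>; both sides are finite sums
  and converge as \<open>t\<close> grows.\<close>

lemma reach_prob_bellman:
  assumes M: "is_mdp M" and f: "selects M \<pi> f" and s0: "s0 \<in> states M"
    and B: "\<forall>s\<in>B. absorbing M s"
  shows "reach_prob M \<pi> s0 B = (\<Sum>s\<in>states M. pmf (tr M s0 (f s0)) s * reach_prob M \<pi> s B)"
proof (rule LIMSEQ_unique)
  note \<pi> = selects_imp_policies[OF f]
  have fin: "finite B"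
    using B finite_states[OF M] by (auto simp: absorbing_def intro: finite_subset)
  show "(\<lambda>t. measure (state_pmf M \<pi> s0 (Suc t)) B) \<longlonglongrightarrow> reach_prob M \<pi> s0 B"
    by (rule LIMSEQ_Suc[OF reach_prob_LIMSEQ[OF M \<pi> s0 B]])
  have "measure (state_pmf M \<pi> s0 (Suc t)) B =
      (\<Sum>s\<in>states M. pmf (tr M s0 (f s0)) s * measure (state_pmf M \<pi> s t) B)" for t
    unfolding measure_measure_pmf_finite[OF fin] pmf_state_pmf_Suc_front[OF M f s0]
    by (subst sum.swap) (simp add: sum_distrib_left mult.commute)
  then show "(\<lambda>t. measure (state_pmf M \<pi> s0 (Suc t)) B)
      \<longlonglongrightarrow> (\<Sum>s\<in>states M. pmf (tr M s0 (f s0)) s * reach_prob M \<pi> s B)"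
    by (simp only:) (intro tendsto_sum tendsto_mult_left reach_prob_LIMSEQ[OF M \<pi> _ B])
qed

text \<open>Unlike \<open>disc_cost\<close>, this allows any starting state, as the Bellman equation
  requires, and it is already in series form.\<close>

definition disc_value ::
  "('s, 'a) mdp \<Rightarrow> real \<Rightarrow> ('s \<Rightarrow> 'a \<Rightarrow> real) \<Rightarrow> ('s, 'a) policy \<Rightarrow> ('s \<Rightarrow> 'a) \<Rightarrow> 's \<Rightarrow> real" where
  "disc_value M \<beta> c \<pi> f s0 =
     (\<Sum>t. \<beta> ^ t * (\<Sum>s\<in>states M. pmf (state_pmf M \<pi> s0 t) s * c s (f s)))"

lemma summable_discounted_pmf_sum:
  fixes \<beta> :: real
  assumes "0 < \<beta>" "\<beta> < 1"
  shows "summable (\<lambda>t. \<beta> ^ t * (\<Sum>s\<in>S. pmf (p t) s * g s))"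
proof (rule summable_comparison_test')
  let ?C = "\<Sum>s\<in>S. \<bar>g s\<bar>"
  show "summable (\<lambda>t. ?C * \<beta> ^ t)"
    using assms by (intro summable_mult summable_geometric) auto
  fix t :: nat assume "0 \<le> t"
  have "\<bar>\<Sum>s\<in>S. pmf (p t) s * g s\<bar> \<le> (\<Sum>s\<in>S. \<bar>pmf (p t) s * g s\<bar>)"
    by (rule sum_abs)
  also have "\<dots> \<le> ?C"
    by (intro sum_mono) (simp add: abs_mult mult_left_le_one_le pmf_le_1)
  finally show "norm (\<beta> ^ t * (\<Sum>s\<in>S. pmf (p t) s * g s)) \<le> ?C * \<beta> ^ t"
    using assms by (simp add: abs_mult mult.commute)
qed

lemma disc_cost_eq_disc_value:
  assumes M: "is_mdp M" and f: "selects M \<pi> f" and \<beta>: "0 < \<beta>" "\<beta> < 1"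
  shows "disc_cost M \<beta> c \<pi> = disc_value M \<beta> c \<pi> f (s_init M)"
proof -
  note \<pi> = selects_imp_policies[OF f]
  have init: "s_init M \<in> states M" using M by (simp add: is_mdp_def)
  have "(\<integral>x. c (fst x) (snd x) \<partial>sa_pmf M \<pi> (s_init M) t) =
      (\<Sum>s\<in>states M. pmf (state_pmf M \<pi> (s_init M) t) s * c s (f s))" for t
  proof -
    note set = set_state_pmf[OF M \<pi> init, of t]
    have "sa_pmf M \<pi> (s_init M) t = map_pmf (\<lambda>s. (s, f s)) (state_pmf M \<pi> (s_init M) t)"
      unfolding sa_pmf_def map_pmf_def
      by (rule bind_pmf_cong) (use f set in \<open>auto simp: selects_def bind_return_pmf\<close>)
    also have "(\<integral>x. c (fst x) (snd x) \<partial>\<dots>) = (\<Sum>s\<in>states M. c s (f s) * pmf (state_pmf M \<pi> (s_init M) t) s)"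
      unfolding integral_map_pmf fst_conv snd_conv
      by (rule integral_measure_pmf_real) (use finite_states[OF M] set in auto)
    finally show ?thesis by (simp add: mult.commute)
  qed
  then show ?thesis
    unfolding disc_cost_eq_suminf[OF M \<pi> \<beta>] disc_value_def by simp
qed

text \<open>The term at time 0 is the immediate cost; the backward equation turns the remaining
  series into values at the successor states.\<close>

lemma disc_value_bellman:
  assumes M: "is_mdp M" and f: "selects M \<pi> f" and s0: "s0 \<in> states M"
    and \<beta>: "0 < \<beta>" "\<beta> < 1"
  shows "disc_value M \<beta> c \<pi> f s0 =
    c s0 (f s0) + \<beta> * (\<Sum>s\<in>states M. pmf (tr M s0 (f s0)) s * disc_value M \<beta> c \<pi> f s)"
proof -
  let ?g = "\<lambda>s0 t. \<beta> ^ t * (\<Sum>s\<in>states M. pmf (state_pmf M \<pi> s0 t) s * c s (f s))"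
  note summ = summable_discounted_pmf_sum[OF \<beta>, where S="states M" and g="\<lambda>s. c s (f s)"]
  have head: "?g s0 0 = c s0 (f s0)"
    using finite_states[OF M] s0 by (simp add: pmf_return indicator_def if_distrib if_distribR sum.delta cong: if_cong)
  have "?g s0 (Suc t) = (\<Sum>s\<in>states M. (\<beta> * pmf (tr M s0 (f s0)) s) * ?g s t)" for t
  proof -
    have "?g s0 (Suc t) = \<beta> ^ Suc t * (\<Sum>s'\<in>states M. \<Sum>s\<in>states M.
        pmf (state_pmf M \<pi> s t) s' * pmf (tr M s0 (f s0)) s * c s' (f s'))"
      unfolding pmf_state_pmf_Suc_front[OF M f s0] by (simp add: sum_distrib_right)
    also have "\<dots> = (\<Sum>s\<in>states M. (\<beta> * pmf (tr M s0 (f s0)) s) * ?g s t)"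
      by (subst sum.swap) (simp add: sum_distrib_left mult_ac)
    finally show ?thesis .
  qed
  then have "(\<Sum>t. ?g s0 (Suc t)) = (\<Sum>t. \<Sum>s\<in>states M. (\<beta> * pmf (tr M s0 (f s0)) s) * ?g s t)"
    by (simp only:)
  also have "\<dots> = (\<Sum>s\<in>states M. \<Sum>t. (\<beta> * pmf (tr M s0 (f s0)) s) * ?g s t)"
    by (rule suminf_sum) (intro summable_mult summ)
  also have "\<dots> = (\<Sum>s\<in>states M. (\<beta> * pmf (tr M s0 (f s0)) s) * disc_value M \<beta> c \<pi> f s)"
    unfolding disc_value_def by (intro sum.cong refl suminf_mult summ)
  finally have "(\<Sum>t. ?g s0 (Suc t)) =
      \<beta> * (\<Sum>s\<in>states M. pmf (tr M s0 (f s0)) s * disc_value M \<beta> c \<pi> f s)"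
    by (simp add: sum_distrib_left mult_ac)
  moreover have "disc_value M \<beta> c \<pi> f s0 = (\<Sum>t. ?g s0 (Suc t)) + ?g s0 0"
    unfolding disc_value_def using suminf_split_head[OF summ[of "state_pmf M \<pi> s0"]] by linarith
  ultimately show ?thesis using head by simp
qed

section \<open>Transitions from outside \<open>Sr\<close>\<close>

lemma pmf_leaves_absorbing:
  assumes "absorbing M s" "a \<in> avail M s" "s' \<noteq> s"
  shows "pmf (tr M s a) s' = 0"
proof -
  have "tr M s a = return_pmf s"
    using assms by (intro pmf_eq_1_imp_return) (auto simp: absorbing_def)
  with assms show ?thesis by (simp add: pmf_return)
qed

text \<open>If a state outside \<open>S0\<close> could be entered from \<open>s\<close>, then
  entering it and following a policy that reaches \<open>B\<close> from there would reach
  \<open>B\<close> from \<open>s\<close> with positive probability.\<close>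

lemma S0_closed:
  assumes M: "is_mdp M" and B: "\<forall>s\<in>B. absorbing M s"
    and s: "s \<in> S0 M B" and a: "a \<in> avail M s" and s': "s' \<in> states M" "s' \<notin> S0 M B"
  shows "pmf (tr M s a) s' = 0"
proof (rule ccontr)
  assume pos: "pmf (tr M s a) s' \<noteq> 0"
  from s' obtain \<pi> where \<pi>: "\<pi> \<in> policies M" "reach_prob M \<pi> s' B \<noteq> 0"
    by (auto simp: S0_def)
  \<comment> \<open>A nonzero limit cannot come from probabilities that all vanish, so
    \<open>B\<close> is hit with positive probability at a finite time.\<close>
  have "\<exists>t. measure (state_pmf M \<pi> s' t) B \<noteq> 0"
  proof (rule ccontr)
    assume "\<not> ?thesis"
    with reach_prob_LIMSEQ[OF M \<pi>(1) s'(1) B] have "(\<lambda>t. 0) \<longlonglongrightarrow> reach_prob M \<pi> s' B"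
      by simp
    with \<pi>(2) show False by (simp add: LIMSEQ_const_iff)
  qed
  then obtain t where t: "measure (state_pmf M \<pi> s' t) B \<noteq> 0" ..
  then obtain b where b: "b \<in> B" "b \<in> set_pmf (state_pmf M \<pi> s' t)"
    by (auto simp: measure_pmf_zero_iff)
  \<comment> \<open>take \<open>a\<close> first, then follow \<open>\<pi>\<close>\<close>
  define \<pi>' where "\<pi>' = (\<lambda>t u. if t = 0 then (if u = s then return_pmf a else \<pi> 0 u) else \<pi> (t - 1) u)"
  have \<pi>': "\<pi>' \<in> policies M"
    using \<pi>(1) a by (auto simp: policies_def \<pi>'_def)
  have "b \<in> set_pmf (state_pmf M \<pi>' s (Suc t))"
    unfolding state_pmf_Suc_front using pos b by (auto simp: \<pi>'_def bind_return_pmf set_pmf_iff[of s'])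
  with b(1) have "measure (state_pmf M \<pi>' s (Suc t)) B \<noteq> 0"
    by (auto simp: measure_pmf_zero_iff)
  then have "0 < measure (state_pmf M \<pi>' s (Suc t)) B"
    using measure_nonneg less_le by metis
  with reach_prob_ge_state_pmf[of M \<pi>' s "Suc t" B] have "reach_prob M \<pi>' s B \<noteq> 0"
    by linarith
  with s \<pi>' show False by (auto simp: S0_def)
qed

text \<open>States outside \<open>Sr\<close> lie in \<open>B\<close> or in \<open>S0\<close>, and
  neither set can be left towards \<open>Sr\<close>. The values of \<open>l2\<close> there, on which
  the program imposes no flow balance, therefore feed nothing into \<open>Sr\<close>.\<close>

lemma no_transition_into_Sr:
  assumes M: "is_mdp M" and B: "\<forall>s\<in>B. absorbing M s"
    and "s \<in> states M" "s \<notin> Sr M B" "a \<in> avail M s" "s' \<in> Sr M B"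
  shows "pmf (tr M s a) s' = 0"
proof (cases "s \<in> B")
  case True
  with assms show ?thesis by (intro pmf_leaves_absorbing) (auto simp: Sr_def)
next
  case False
  with assms show ?thesis by (intro S0_closed[OF M B]) (auto simp: Sr_def)
qed

section \<open>Feasible points and policies\<close>

text \<open>Used with \<open>u\<close> a value function, so that on the support of \<open>l\<close> the bracket is the one-step
  reward by the Bellman equation.\<close>

lemma flow_duality:
  fixes l P :: "'s \<Rightarrow> 'a \<Rightarrow> _" and u \<alpha> :: "'s \<Rightarrow> real" and \<gamma> :: real
  assumes fin: "finite S" and T: "T \<subseteq> S"
    and flow: "\<And>s. s \<in> T \<Longrightarrow>
      (\<Sum>a\<in>A s. l s a) - \<gamma> * (\<Sum>s'\<in>S. \<Sum>a\<in>A s'. P s' a s * l s' a) = \<alpha> s"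
  shows "(\<Sum>s\<in>S. \<Sum>a\<in>A s. l s a * ((if s \<in> T then u s else 0) - \<gamma> * (\<Sum>s'\<in>T. P s a s' * u s')))
    = (\<Sum>s\<in>T. \<alpha> s * u s)"
proof -
  have 1: "(\<Sum>s\<in>S. \<Sum>a\<in>A s. l s a * (if s \<in> T then u s else 0)) = (\<Sum>s\<in>T. (\<Sum>a\<in>A s. l s a) * u s)"
    using fin T by (intro sum.mono_neutral_cong_right) (auto simp: sum_distrib_right)
  \<comment> \<open>Swapping sums turns expected values at the successors into inflows weighted by
    \<open>u\<close>.\<close>
  have "(\<Sum>s\<in>S. \<Sum>a\<in>A s. l s a * (\<gamma> * (\<Sum>s'\<in>T. P s a s' * u s'))) =
      (\<Sum>s\<in>S. \<Sum>s'\<in>T. \<Sum>a\<in>A s. \<gamma> * (P s a s' * l s a) * u s')"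
  proof (rule sum.cong[OF refl])
    fix s
    show "(\<Sum>a\<in>A s. l s a * (\<gamma> * (\<Sum>s'\<in>T. P s a s' * u s'))) =
        (\<Sum>s'\<in>T. \<Sum>a\<in>A s. \<gamma> * (P s a s' * l s a) * u s')"
      by (subst sum.swap) (simp add: sum_distrib_left mult_ac)
  qed
  also have "\<dots> = (\<Sum>s\<in>T. (\<gamma> * (\<Sum>s'\<in>S. \<Sum>a\<in>A s'. P s' a s * l s' a)) * u s)"
    by (subst sum.swap) (simp add: sum_distrib_left sum_distrib_right)
  finally have 2: "(\<Sum>s\<in>S. \<Sum>a\<in>A s. l s a * (\<gamma> * (\<Sum>s'\<in>T. P s a s' * u s'))) =
      (\<Sum>s\<in>T. (\<gamma> * (\<Sum>s'\<in>S. \<Sum>a\<in>A s'. P s' a s * l s' a)) * u s)" .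
  have "(\<Sum>s\<in>S. \<Sum>a\<in>A s. l s a * ((if s \<in> T then u s else 0) - \<gamma> * (\<Sum>s'\<in>T. P s a s' * u s'))) =
      (\<Sum>s\<in>T. (\<Sum>a\<in>A s. l s a) * u s) -
      (\<Sum>s\<in>T. (\<gamma> * (\<Sum>s'\<in>S. \<Sum>a\<in>A s'. P s' a s * l s' a)) * u s)"
    unfolding 1[symmetric] 2[symmetric] by (simp only: right_diff_distrib sum_subtractf)
  also have "\<dots> = (\<Sum>s\<in>T. \<alpha> s * u s)"
    unfolding sum_subtractf[symmetric] left_diff_distrib[symmetric] using flow by (intro sum.cong) auto
  finally show ?thesis .
qed

section \<open>Evaluating the objective and the reachability constraint\<close>

lemma Sr_subset: "Sr M B \<subseteq> states M"
  by (auto simp: Sr_def)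

lemma sum_init_weight:
  assumes "finite T"
  shows "(\<Sum>s\<in>T. init_weight M s * u s) = (if s_init M \<in> T then u (s_init M) else 0)"
  using assms by (simp add: init_weight_def if_distrib if_distribR sum.delta cong: if_cong)

text \<open>Duality with \<open>u\<close> the discounted value: on the support of \<open>l\<close>
  the bracket is the immediate cost, and the initial weights pick out the value at
  \<open>s_init M\<close>. No uniqueness of the flow has to be shown.\<close>

lemma objective_eq_disc_cost:
  assumes M: "is_mdp M" and f: "selects M \<pi> f" and \<beta>: "0 < \<beta>" "\<beta> < 1"
    and flow: "\<And>s. s \<in> states M \<Longrightarrow> (\<Sum>a\<in>avail M s. l s a)
      - \<beta> * (\<Sum>s'\<in>states M. \<Sum>a\<in>avail M s'. pmf (tr M s' a) s * l s' a) = init_weight M s"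
    and supp: "\<And>s a. s \<in> states M \<Longrightarrow> a \<in> avail M s \<Longrightarrow> l s a \<noteq> 0 \<Longrightarrow> a = f s"
  shows "milp_objective M c l = disc_cost M \<beta> c \<pi>"
proof -
  let ?W = "disc_value M \<beta> c \<pi> f"
  have init: "s_init M \<in> states M" using M by (simp add: is_mdp_def)
  have "milp_objective M c l = (\<Sum>s\<in>states M. \<Sum>a\<in>avail M s.
      l s a * ((if s \<in> states M then ?W s else 0) - \<beta> * (\<Sum>s'\<in>states M. pmf (tr M s a) s' * ?W s')))"
    unfolding milp_objective_def
  proof (intro sum.cong refl)
    fix s a assume sa: "s \<in> states M" "a \<in> avail M s"
    show "c s a * l s a =
        l s a * ((if s \<in> states M then ?W s else 0) - \<beta> * (\<Sum>s'\<in>states M. pmf (tr M s a) s' * ?W s'))"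
    proof (cases "l s a = 0")
      case False
      with supp sa have "a = f s" by auto
      with disc_value_bellman[OF M f sa(1) \<beta>, of c] sa show ?thesis by simp
    qed simp
  qed
  also have "\<dots> = (\<Sum>s\<in>states M. init_weight M s * ?W s)"
    by (rule flow_duality[OF finite_states[OF M] order_refl flow])
  also have "\<dots> = disc_cost M \<beta> c \<pi>"
    using init by (simp add: sum_init_weight finite_states[OF M] disc_cost_eq_disc_value[OF M f \<beta>])
  finally show ?thesis .
qed

text \<open>Duality on \<open>Sr\<close> with factor 1 and \<open>u\<close> the reachability
  probability. Since \<open>u\<close> is 1 on \<open>B\<close> and 0 on \<open>S0\<close>, the
  Bellman equation leaves the probability of stepping into \<open>B\<close>, which is
  \<open>reach_reward\<close>.\<close>

lemma reach_constraint_eq_reach_prob: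
  assumes M: "is_mdp M" and f: "selects M \<pi> f"
    and B: "\<forall>s\<in>B. absorbing M s" and init: "s_init M \<notin> B"
    and flow: "\<And>s. s \<in> Sr M B \<Longrightarrow> (\<Sum>a\<in>avail M s. l s a)
      - (\<Sum>s'\<in>states M. \<Sum>a\<in>avail M s'. pmf (tr M s' a) s * l s' a) = init_weight M s"
    and supp: "\<And>s a. s \<in> states M \<Longrightarrow> a \<in> avail M s \<Longrightarrow> l s a \<noteq> 0 \<Longrightarrow> a = f s"
  shows "(\<Sum>s\<in>Sr M B. \<Sum>a\<in>avail M s. l s a * reach_reward M B s a) =
    reach_prob M \<pi> (s_init M) B"
proof -
  let ?V = "\<lambda>s. reach_prob M \<pi> s B"
  have fin: "finite (states M)" "finite (Sr M B)" "finite B"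
    using finite_states[OF M] Sr_subset[of M B] B by (auto simp: absorbing_def intro: finite_subset)
  have V0: "?V s = 0" if "s \<in> S0 M B" for s
    using that selects_imp_policies[OF f] by (auto simp: S0_def)
  have split: "(\<Sum>s'\<in>states M. p s' * ?V s') = (\<Sum>s'\<in>Sr M B. p s' * ?V s') + (\<Sum>s'\<in>B. p s')" for p
  proof -
    have "(\<Sum>s'\<in>states M. p s' * ?V s') = (\<Sum>s'\<in>Sr M B \<union> B. p s' * ?V s')"
      using fin B V0 by (intro sum.mono_neutral_right) (auto simp: Sr_def absorbing_def)
    also have "\<dots> = (\<Sum>s'\<in>Sr M B. p s' * ?V s') + (\<Sum>s'\<in>B. p s' * ?V s')"
      using fin by (intro sum.union_disjoint) (auto simp: Sr_def)
    finally show ?thesis by (simp add: reach_prob_target)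
  qed
  have "(\<Sum>s\<in>Sr M B. \<Sum>a\<in>avail M s. l s a * reach_reward M B s a) =
      (\<Sum>s\<in>states M. \<Sum>a\<in>avail M s. l s a * reach_reward M B s a)"
    using fin Sr_subset[of M B] by (intro sum.mono_neutral_left) (auto simp: reach_reward_def)
  also have "\<dots> = (\<Sum>s\<in>states M. \<Sum>a\<in>avail M s.
      l s a * ((if s \<in> Sr M B then ?V s else 0) - 1 * (\<Sum>s'\<in>Sr M B. pmf (tr M s a) s' * ?V s')))"
  proof (intro sum.cong refl)
    fix s a assume sa: "s \<in> states M" "a \<in> avail M s"
    show "l s a * reach_reward M B s a =
        l s a * ((if s \<in> Sr M B then ?V s else 0) - 1 * (\<Sum>s'\<in>Sr M B. pmf (tr M s a) s' * ?V s'))"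
    proof (cases "l s a = 0")
      case False
      with supp sa have a: "a = f s" by auto
      show ?thesis
      proof (cases "s \<in> Sr M B")
        case True
        have "?V s = (\<Sum>s'\<in>Sr M B. pmf (tr M s a) s' * ?V s') + (\<Sum>s'\<in>B. pmf (tr M s a) s')"
          unfolding a using reach_prob_bellman[OF M f sa(1) B] split by simp
        with True show ?thesis by (simp add: reach_reward_def)
      next
        case False
        \<comment> \<open>Outside \<open>Sr\<close> the reward is 0, and the bracket vanishes too
          because no successor lies in \<open>Sr\<close>.\<close>
        with no_transition_into_Sr[OF M B sa(1) False sa(2)] show ?thesis
          by (simp add: reach_reward_def)
      qed
    qed simp
  qed
  also have "\<dots> = (\<Sum>s\<in>Sr M B. init_weight M s * ?V s)"
    by (rule flow_duality[OF fin(1) Sr_subset]) (use flow in simp)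
  also have "\<dots> = (if s_init M \<in> Sr M B then ?V (s_init M) else 0)"
    by (rule sum_init_weight[OF fin(2)])
  \<comment> \<open>An initial state outside \<open>Sr\<close> lies in \<open>S0\<close>, as
    \<open>B\<close> is excluded, and has value 0 there.\<close>
  also have "\<dots> = ?V (s_init M)"
    using M init V0 by (auto simp: Sr_def is_mdp_def)
  finally show ?thesis .
qed

text \<open>A positive flow makes the binary \<open>D s a\<close> positive, hence 1, and then row
  \<open>s\<close> sums to exactly 1. The extraction rule must therefore pick \<open>a\<close>; it
  chooses arbitrarily only in states where both flows vanish.\<close>

lemma milp_feasible_support:
  assumes M: "is_mdp M" and feas: "milp_feasible M B \<beta> L l1 l2 D" and L: "0 < L"
    and \<pi>: "\<pi> \<in> extracted_policies M D" and f: "selects M \<pi> f"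
    and sa: "s \<in> states M" "a \<in> avail M s" and nz: "l1 s a \<noteq> 0 \<or> l2 s a \<noteq> 0"
  shows "a = f s"
proof -
  have D: "\<forall>a\<in>avail M s. D s a \<in> {0, 1}" and le: "(\<Sum>a\<in>avail M s. D s a) \<le> 1"
    and l: "0 \<le> l1 s a" "0 \<le> l2 s a" "l1 s a / L \<le> D s a" "l2 s a / L \<le> D s a"
    using feas sa by (auto simp: milp_feasible_def)
  have "0 < l1 s a / L \<or> 0 < l2 s a / L"
    using l nz L by (auto simp: less_le)
  with l D sa have Da: "D s a = 1" by auto
  have "D s a \<le> (\<Sum>a\<in>avail M s. D s a)"
    using D sa finite_avail[OF M sa(1)] by (intro member_le_sum) force+
  with le Da have "(\<Sum>a\<in>avail M s. D s a) = 1" by simp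
  with \<pi> sa Da have "pmf (\<pi> 0 s) a = 1" by (simp add: extracted_policies_def)
  with f sa show ?thesis by (auto simp: selects_def pmf_return indicator_def split: if_splits)
qed

lemma milp_feasible_sound:
  assumes M: "is_mdp M" and B: "\<forall>s\<in>B. absorbing M s" "s_init M \<notin> B"
    and \<beta>: "0 < \<beta>" "\<beta> < 1" and L: "0 < L"
    and feas: "milp_feasible M B \<beta> L l1 l2 D" and \<pi>: "\<pi> \<in> extracted_policies M D"
  shows "\<pi> \<in> policies_Xi M B" "disc_cost M \<beta> c \<pi> = milp_objective M c l1"
proof -
  have SD: "\<pi> \<in> policies_SD M" using \<pi> by (simp add: extracted_policies_def)
  then obtain f where f: "selects M \<pi> f" by (rule policies_SD_selects)
  note supp = milp_feasible_support[OF M feas L \<pi> f]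
  show "disc_cost M \<beta> c \<pi> = milp_objective M c l1"
    by (rule objective_eq_disc_cost[OF M f \<beta>, symmetric])
      (use feas supp in \<open>auto simp: milp_feasible_def\<close>)
  have "(\<Sum>s\<in>Sr M B. \<Sum>a\<in>avail M s. l2 s a * reach_reward M B s a) = reach_prob M \<pi> (s_init M) B"
    by (rule reach_constraint_eq_reach_prob[OF M f B])
      (use feas supp in \<open>auto simp: milp_feasible_def\<close>)
  with feas SD show "\<pi> \<in> policies_Xi M B"
    by (simp add: milp_feasible_def policies_Xi_def)
qed

text \<open>A binary row with sum 1 has exactly one entry 1, which names the action; in other states
  any available action will do.\<close>

lemma extracted_policies_nonempty:
  assumes M: "is_mdp M" and feas: "milp_feasible M B \<beta> L l1 l2 D"
  shows "extracted_policies M D \<noteq> {}"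
proof -
  have "\<exists>a. a \<in> avail M s \<and> ((\<Sum>a\<in>avail M s. D s a) = 1 \<longrightarrow> (\<forall>b\<in>avail M s. D s b = indicator {a} b))"
    if s: "s \<in> states M" for s
  proof (cases "(\<Sum>a\<in>avail M s. D s a) = 1")
    case True
    have D: "\<And>a. a \<in> avail M s \<Longrightarrow> D s a = 0 \<or> D s a = 1"
      using feas s by (auto simp: milp_feasible_def)
    with True obtain a where a: "a \<in> avail M s" "D s a = 1"
      by (metis sum.neutral zero_neq_one)
    have "(\<Sum>b\<in>avail M s - {a}. D s b) = 0"
      using True a finite_avail[OF M s] by (simp add: sum.remove)
    moreover have "\<forall>b\<in>avail M s - {a}. 0 \<le> D s b" using D by fastforce
    ultimately have "\<forall>b\<in>avail M s - {a}. D s b = 0"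
      using finite_avail[OF M s] sum_nonneg_eq_0_iff[of "avail M s - {a}" "D s"] by auto
    with a show ?thesis by (intro exI[of _ a]) (auto simp: indicator_def)
  next
    case False
    from M s have "avail M s \<noteq> {}" by (simp add: is_mdp_def)
    with False show ?thesis by auto
  qed
  then obtain f where f: "\<And>s. s \<in> states M \<Longrightarrow> f s \<in> avail M s"
    "\<And>s b. s \<in> states M \<Longrightarrow> (\<Sum>a\<in>avail M s. D s a) = 1 \<Longrightarrow> b \<in> avail M s \<Longrightarrow> D s b = indicator {f s} b"
    by metis
  have f_D: "pmf (return_pmf (f s)) a = D s a"
    if "s \<in> states M" "(\<Sum>a\<in>avail M s. D s a) = 1" "a \<in> avail M s" for s a
    using f(2)[OF that] by (simp add: indicator_def)
  have "(\<lambda>_ s. return_pmf (f s)) \<in> policies_SD M"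
    by (rule selects_imp_policies_SD[of _ _ f]) (simp add: selects_def f)
  then have "(\<lambda>_ s. return_pmf (f s)) \<in> extracted_policies M D"
    using f_D by (simp add: extracted_policies_def)
  then show ?thesis by auto
qed

text \<open>The witnesses are the occupation measures of the policy: \<open>l1\<close> discounted,
  and \<open>l2\<close> undiscounted but counted on \<open>Sr\<close> only.\<close>

lemma milp_feasible_complete:
  assumes M: "is_mdp M" and B: "\<forall>s\<in>B. absorbing M s" "s_init M \<notin> B"
    and \<beta>: "0 < \<beta>" "\<beta> < 1"
    and L: "M_star M B \<le> ennreal L" "1 / (1 - \<beta>) \<le> L"
    and \<pi>: "\<pi> \<in> policies_Xi M B"
  obtains l1 l2 D where "milp_feasible M B \<beta> L l1 l2 D" "milp_objective M c l1 = disc_cost M \<beta> c \<pi>"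
proof -
  obtain f where f: "selects M \<pi> f"
    using \<pi> policies_SD_selects by (auto simp: policies_Xi_def)
  have init: "s_init M \<in> states M" using M by (simp add: is_mdp_def)
  note fin = finite_states[OF M]
  have finr: "finite (Sr M B)" by (rule finite_subset[OF Sr_subset fin])
  have L0: "0 < L"
  proof -
    have "0 < 1 / (1 - \<beta>)" using \<beta> by simp
    with L(2) show ?thesis by linarith
  qed
  define p where "p t s = pmf (state_pmf M \<pi> (s_init M) t) s" for t s
  have p0: "p 0 s = init_weight M s" for s
    by (simp add: p_def init_weight_def pmf_return)
  have pSuc: "p (Suc t) s' = (\<Sum>s\<in>states M. pmf (tr M s (f s)) s' * p t s)" for t s'
    unfolding p_def by (rule pmf_state_pmf_Suc[OF M f init])
  have p_nonneg: "0 \<le> p t s" and p_le: "p t s \<le> 1" for t s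
    by (simp_all add: p_def pmf_le_1)
  have summ1: "summable (\<lambda>t. \<beta> ^ t * p t s)" for s
    by (rule summable_comparison_test'[where g="\<lambda>t. \<beta> ^ t"])
      (use \<beta> p_nonneg p_le in \<open>auto intro: summable_geometric simp: abs_mult mult_left_le\<close>)
  \<comment> \<open>The policy competes in the supremum \<open>M_star\<close>, so its expected
    residence time in \<open>Sr\<close> is at most \<open>L\<close>, in particular finite. This
    gives both the convergence and the bound of \<open>l2\<close>.\<close>
  have Sr_sum: "(\<Sum>t. ennreal (\<Sum>s\<in>Sr M B. p t s)) \<le> ennreal L"
  proof -
    have "(\<Sum>t. ennreal (\<Sum>s\<in>Sr M B. p t s)) \<le> M_star M B"
      unfolding M_star_def nn_integral_stay_reward p_def measure_measure_pmf_finite[OF finr]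
      using \<pi> by (rule SUP_upper)
    with L(1) show ?thesis by simp
  qed
  have summr: "summable (\<lambda>t. \<Sum>s\<in>Sr M B. p t s)"
    using Sr_sum p_nonneg by (intro summable_suminf_not_top) (auto simp: sum_nonneg top_unique)
  have p_le_Sr: "p t s \<le> (\<Sum>s\<in>Sr M B. p t s)" if "s \<in> Sr M B" for t s
    using that finr p_nonneg by (intro member_le_sum) auto
  have summ2: "summable (\<lambda>t. p t s)" if "s \<in> Sr M B" for s
    using p_le_Sr[OF that] p_nonneg by (intro summable_comparison_test'[OF summr, of 0]) auto
  define y1 where "y1 s = (\<Sum>t. \<beta> ^ t * p t s)" for s
  \<comment> \<open>Outside \<open>Sr\<close> the series may diverge, since an absorbing state is
    occupied forever once entered; there the flow is set to 0.\<close>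
  define y2 where "y2 s = (if s \<in> Sr M B then \<Sum>t. p t s else 0)" for s
  have y1_nonneg: "0 \<le> y1 s" for s
    unfolding y1_def using \<beta> p_nonneg summ1 by (intro suminf_nonneg) auto
  have y2_nonneg: "0 \<le> y2 s" for s
    unfolding y2_def using p_nonneg summ2 by (auto intro: suminf_nonneg)
  have y1_le: "y1 s \<le> L" for s
  proof -
    have "y1 s \<le> (\<Sum>t. \<beta> ^ t)"
      unfolding y1_def using \<beta> p_le by (intro suminf_le summ1 summable_geometric) (auto simp: mult_left_le)
    also have "\<dots> = 1 / (1 - \<beta>)" using \<beta> by (intro suminf_geometric) auto
    finally show ?thesis using L(2) by simp
  qed
  have y2_le: "y2 s \<le> L" for s
  proof (cases "s \<in> Sr M B")
    case True
    have "y2 s \<le> (\<Sum>t. \<Sum>s\<in>Sr M B. p t s)"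
      using True p_le_Sr summ2 summr by (auto simp: y2_def intro!: suminf_le)
    also have "ennreal \<dots> = (\<Sum>t. ennreal (\<Sum>s\<in>Sr M B. p t s))"
      using summr p_nonneg by (intro suminf_ennreal2[symmetric]) (auto simp: sum_nonneg)
    then have "(\<Sum>t. \<Sum>s\<in>Sr M B. p t s) \<le> L"
      using Sr_sum L0 by (subst ennreal_le_iff[symmetric]) auto
    finally show ?thesis .
  qed (use L0 in \<open>simp add: y2_def\<close>)
  have flow1: "y1 s' - \<beta> * (\<Sum>s\<in>states M. pmf (tr M s (f s)) s' * y1 s) = init_weight M s'" for s'
  proof -
    \<comment> \<open>The term at time 0 is the source \<open>init_weight\<close>; by the forward
      equation the remaining terms make up the discounted inflow.\<close>
    have "(\<Sum>t. \<beta> ^ Suc t * p (Suc t) s') =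
        (\<Sum>t. \<Sum>s\<in>states M. (\<beta> * pmf (tr M s (f s)) s') * (\<beta> ^ t * p t s))"
      by (simp add: pSuc sum_distrib_left mult_ac)
    also have "\<dots> = (\<Sum>s\<in>states M. \<Sum>t. (\<beta> * pmf (tr M s (f s)) s') * (\<beta> ^ t * p t s))"
      by (rule suminf_sum) (intro summable_mult summ1)
    also have "\<dots> = \<beta> * (\<Sum>s\<in>states M. pmf (tr M s (f s)) s' * y1 s)"
      unfolding y1_def sum_distrib_left by (subst suminf_mult[OF summ1]) (simp add: mult_ac)
    finally show ?thesis
      using suminf_split_head[OF summ1[of s']] by (simp add: y1_def p0)
  qed
  have flow2: "y2 s' - (\<Sum>s\<in>states M. pmf (tr M s (f s)) s' * y2 s) = init_weight M s'"
    if s': "s' \<in> Sr M B" for s'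
  proof -
    have fa: "f s \<in> avail M s" if "s \<in> states M" for s
      using f that by (simp add: selects_def)
    \<comment> \<open>Inflow into \<open>Sr\<close> comes from \<open>Sr\<close> alone, so setting
      \<open>y2\<close> to 0 elsewhere does not disturb the balance.\<close>
    have restr: "(\<Sum>s\<in>states M. pmf (tr M s (f s)) s' * g s) = (\<Sum>s\<in>Sr M B. pmf (tr M s (f s)) s' * g s)" for g
      using no_transition_into_Sr[OF M B(1) _ _ fa s'] fin Sr_subset[of M B]
      by (intro sum.mono_neutral_right) auto
    have "(\<Sum>t. p (Suc t) s') = (\<Sum>t. \<Sum>s\<in>Sr M B. pmf (tr M s (f s)) s' * p t s)"
      by (simp add: pSuc restr)
    also have "\<dots> = (\<Sum>s\<in>Sr M B. \<Sum>t. pmf (tr M s (f s)) s' * p t s)"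
      by (rule suminf_sum) (intro summable_mult summ2)
    also have "\<dots> = (\<Sum>s\<in>Sr M B. pmf (tr M s (f s)) s' * y2 s)"
      by (intro sum.cong refl) (simp add: y2_def suminf_mult summ2)
    finally show ?thesis
      using suminf_split_head[OF summ2[OF s']] s' by (simp add: restr y2_def p0)
  qed
  define l1 where "l1 s a = (if a = f s then y1 s else 0)" for s a
  define l2 where "l2 s a = (if a = f s then y2 s else 0)" for s a
  define D where "D s a = (if a = f s then 1 else 0 :: real)" for s a
  have sel: "(\<Sum>a\<in>avail M s. g a * (if a = f s then h else 0)) = g (f s) * h"
    if "s \<in> states M" for s and g :: "'b \<Rightarrow> real" and h
  proof -
    have "f s \<in> avail M s" using f that by (simp add: selects_def)
    then show ?thesis
      using finite_avail[OF M that] by (simp add: if_distrib sum.delta' cong: if_cong)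
  qed
  have sel1: "(\<Sum>a\<in>avail M s. if a = f s then h else 0) = (h::real)" if "s \<in> states M" for s h
    using sel[OF that, of "\<lambda>_. 1" h] by simp
  have Fl1: "(\<Sum>a\<in>avail M s. l1 s a)
      - \<beta> * (\<Sum>s'\<in>states M. \<Sum>a\<in>avail M s'. pmf (tr M s' a) s * l1 s' a) = init_weight M s"
    if "s \<in> states M" for s
    using flow1[of s] that by (simp add: l1_def sel sel1 cong: sum.cong)
  have Fl2: "(\<Sum>a\<in>avail M s. l2 s a)
      - (\<Sum>s'\<in>states M. \<Sum>a\<in>avail M s'. pmf (tr M s' a) s * l2 s' a) = init_weight M s"
    if "s \<in> Sr M B" for s
    using flow2[OF that] that Sr_subset[of M B] by (simp add: l2_def sel sel1 subset_iff cong: sum.cong)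
  \<comment> \<open>The flow balance of \<open>l2\<close> suffices to evaluate this sum by
    duality.\<close>
  have "(\<Sum>s\<in>Sr M B. \<Sum>a\<in>avail M s. l2 s a * reach_reward M B s a) = reach_prob M \<pi> (s_init M) B"
    by (rule reach_constraint_eq_reach_prob[OF M f B Fl2]) (auto simp: l2_def split: if_splits)
  also have "\<dots> = max_reach_prob M B"
    using \<pi> by (simp add: policies_Xi_def)
  finally have "milp_feasible M B \<beta> L l1 l2 D"
    unfolding milp_feasible_def using Fl1 Fl2 L0 y1_nonneg y2_nonneg y1_le y2_le
    by (auto simp: D_def sel1) (auto simp: l1_def l2_def)
  moreover have "milp_objective M c l1 = disc_cost M \<beta> c \<pi>"
    by (rule objective_eq_disc_cost[OF M f \<beta> Fl1]) (auto simp: l1_def split: if_splits)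
  ultimately show ?thesis by (rule that)
qed

text \<open>The cost depends only on the choice function restricted to \<open>states M\<close>, and
  there are finitely many of these. The policies themselves may be infinitely many, being arbitrary
  outside \<open>states M\<close>.\<close>

lemma finite_disc_cost_Xi:
  assumes M: "is_mdp M" and \<beta>: "0 < \<beta>" "\<beta> < 1"
  shows "finite (disc_cost M \<beta> c ` policies_Xi M B)"
proof (rule finite_subset)
  let ?F = "PiE (states M) (avail M)"
  show "finite ((\<lambda>f. disc_cost M \<beta> c (\<lambda>_ s. return_pmf (f s))) ` ?F)"
    using M by (intro finite_imageI finite_PiE finite_avail finite_states)
  show "disc_cost M \<beta> c ` policies_Xi M B \<subseteq> (\<lambda>f. disc_cost M \<beta> c (\<lambda>_ s. return_pmf (f s))) ` ?F"
  proof safe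
    fix \<pi> assume "\<pi> \<in> policies_Xi M B"
    then obtain f where f: "selects M \<pi> f"
      using policies_SD_selects by (auto simp: policies_Xi_def)
    define g where "g = restrict f (states M)"
    have g: "selects M \<pi> g" and g': "selects M (\<lambda>_ s. return_pmf (g s)) g"
      using f by (auto simp: selects_def g_def)
    have init: "s_init M \<in> states M" using M by (simp add: is_mdp_def)
    have "state_pmf M \<pi> (s_init M) t = state_pmf M (\<lambda>_ s. return_pmf (g s)) (s_init M) t" for t
      by (rule state_pmf_cong[OF M selects_imp_policies[OF g] init]) (use g in \<open>auto simp: selects_def\<close>)
    then have "disc_cost M \<beta> c \<pi> = disc_cost M \<beta> c (\<lambda>_ s. return_pmf (g s))"
      unfolding disc_cost_eq_disc_value[OF M g \<beta>] disc_cost_eq_disc_value[OF M g' \<beta>] disc_value_def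
      by simp
    moreover have "g \<in> ?F" using f by (auto simp: selects_def g_def)
    ultimately show "disc_cost M \<beta> c \<pi> \<in> (\<lambda>f. disc_cost M \<beta> c (\<lambda>_ s. return_pmf (f s))) ` ?F"
      by (rule image_eqI)
  qed
qed

section \<open>Equivalence with the program and extraction of an optimal policy\<close>

theorem theorem4:
  fixes M :: "('s, 'a) mdp"
    and B :: "'s set"
    and c :: "'s \<Rightarrow> 'a \<Rightarrow> real"
    and \<beta> L K :: real
  assumes "is_mdp M"
    and "\<forall>s\<in>B. absorbing M s"
    and "s_init M \<notin> B"
    and "\<forall>s\<in>states M. \<forall>a\<in>actions M. 0 \<le> c s a"
    and "0 < \<beta>" and "\<beta> < 1"
    and "M_star M B \<le> ennreal L"
    and "1 / (1 - \<beta>) \<le> L"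
  shows "((\<exists>\<pi>\<in>policies_Xi M B. disc_cost M \<beta> c \<pi> \<le> K) \<longleftrightarrow> milp_value M B c \<beta> L \<le> ereal K) \<and>
    (milp_value M B c \<beta> L \<le> ereal K \<longrightarrow>
       (\<exists>l1 l2 D. milp_optimal M B c \<beta> L l1 l2 D) \<and>
       (\<forall>l1 l2 D. milp_optimal M B c \<beta> L l1 l2 D \<longrightarrow>
          extracted_policies M D \<noteq> {} \<and>
          (\<forall>\<pi>\<in>extracted_policies M D.
             \<pi> \<in> policies_Xi M B \<and>
             (\<forall>\<pi>'\<in>policies_Xi M B. disc_cost M \<beta> c \<pi> \<le> disc_cost M \<beta> c \<pi>') \<and>
             disc_cost M \<beta> c \<pi> \<le> K)))"
proof -
  let ?J = "disc_cost M \<beta> c" and ?v = "milp_value M B c \<beta> L"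
  let ?X = "?J ` policies_Xi M B"
  have L: "0 < L"
  proof -
    have "0 < 1 / (1 - \<beta>)" using assms(6) by simp
    with assms(8) show ?thesis by linarith
  qed
  note sound = milp_feasible_sound[OF assms(1-3,5,6) L]
  note complete = milp_feasible_complete[OF assms(1-3,5-8), where c = c]
  \<comment> \<open>Any policy extracted from a feasible point has the objective as its cost;
    conversely the occupation measures of a policy realize its cost as an objective.\<close>
  have "{ereal (milp_objective M c l1) | l1 l2 D. milp_feasible M B \<beta> L l1 l2 D} = ereal ` ?X"
  proof (intro equalityI subsetI)
    fix z assume "z \<in> {ereal (milp_objective M c l1) | l1 l2 D. milp_feasible M B \<beta> L l1 l2 D}"
    then obtain l1 l2 D where z: "z = ereal (milp_objective M c l1)"
      and feas: "milp_feasible M B \<beta> L l1 l2 D" by auto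
    obtain \<pi> where "\<pi> \<in> extracted_policies M D"
      using extracted_policies_nonempty[OF assms(1) feas] by auto
    from sound(1)[OF feas this] sound(2)[OF feas this, of c] z show "z \<in> ereal ` ?X"
      by (metis image_eqI)
  next
    fix z assume "z \<in> ereal ` ?X"
    then obtain \<pi> where \<pi>: "\<pi> \<in> policies_Xi M B" and z: "z = ereal (?J \<pi>)" by auto
    from \<pi> obtain l1 l2 D where "milp_feasible M B \<beta> L l1 l2 D" "milp_objective M c l1 = ?J \<pi>"
      by (rule complete)
    with z show "z \<in> {ereal (milp_objective M c l1) | l1 l2 D. milp_feasible M B \<beta> L l1 l2 D}"
      by (metis (mono_tags, lifting) mem_Collect_eq)
  qed
  then have v: "?v = Inf (ereal ` ?X)" by (simp add: milp_value_def)
  have le: "?v \<le> ereal (?J \<pi>)" if "\<pi> \<in> policies_Xi M B" for \<pi>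
    unfolding v using that by (intro Inf_lower) auto
  \<comment> \<open>A value below a real number rules out the empty set, whose infimum is infinite,
    and a finite nonempty set attains its infimum.\<close>
  have att: "\<exists>\<pi>\<in>policies_Xi M B. ?v = ereal (?J \<pi>)" if "?v \<le> ereal K"
  proof -
    have "ereal ` ?X \<noteq> {}" using that unfolding v by (auto simp: top_ereal_def)
    moreover have "finite (ereal ` ?X)"
      using finite_disc_cost_Xi[OF assms(1,5,6)] by (rule finite_imageI)
    ultimately have "Inf (ereal ` ?X) \<in> ereal ` ?X"
      by (metis Min_Inf Min_in)
    with v show ?thesis by auto
  qed
  show ?thesis
  proof (intro conjI impI allI ballI)
    show "(\<exists>\<pi>\<in>policies_Xi M B. ?J \<pi> \<le> K) \<longleftrightarrow> ?v \<le> ereal K"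
    proof
      assume "\<exists>\<pi>\<in>policies_Xi M B. ?J \<pi> \<le> K"
      then obtain \<pi> where "\<pi> \<in> policies_Xi M B" "?J \<pi> \<le> K" by auto
      with le[of \<pi>] show "?v \<le> ereal K" by (auto intro: order_trans)
    next
      assume "?v \<le> ereal K"
      with att show "\<exists>\<pi>\<in>policies_Xi M B. ?J \<pi> \<le> K" by force
    qed
  next
    assume "?v \<le> ereal K"
    then obtain \<pi> where \<pi>: "\<pi> \<in> policies_Xi M B" "?v = ereal (?J \<pi>)" using att by auto
    from \<pi>(1) obtain l1 l2 D where "milp_feasible M B \<beta> L l1 l2 D" "milp_objective M c l1 = ?J \<pi>"
      by (rule complete)
    with \<pi>(2) show "\<exists>l1 l2 D. milp_optimal M B c \<beta> L l1 l2 D"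
      unfolding milp_optimal_def by metis
  next
    fix l1 l2 D assume "milp_optimal M B c \<beta> L l1 l2 D"
    then show "extracted_policies M D \<noteq> {}"
      using extracted_policies_nonempty[OF assms(1)] by (auto simp: milp_optimal_def)
  next
    fix l1 l2 D \<pi>
    assume K: "?v \<le> ereal K" and opt: "milp_optimal M B c \<beta> L l1 l2 D"
      and \<pi>: "\<pi> \<in> extracted_policies M D"
    from opt have feas: "milp_feasible M B \<beta> L l1 l2 D" by (simp add: milp_optimal_def)
    note s = sound[OF feas \<pi>]
    have J: "ereal (?J \<pi>) = ?v" using opt unfolding s(2) milp_optimal_def by simp
    show "\<pi> \<in> policies_Xi M B" by (rule s(1))
    show "?J \<pi> \<le> K" using K unfolding J[symmetric] by simp
    show "?J \<pi> \<le> ?J \<pi>'" if "\<pi>' \<in> policies_Xi M B" for \<pi>'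
      using le[OF that] unfolding J[symmetric] by simp
  qed
qed

end
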